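(* There is a universal constant $c>0$ such that for every $n\ge2$ and every origin-symmetric convex body $K\subset\mathbb R^n$ there are vectors $\xi,\nu\in S^{n-1}$ with $\xi\ne\pm\nu$ and $$\mathrm{Vol}_{n-1}(K\cap\xi^\perp)\ge c\,\sqrt{\mathrm{Vol}_{n-2}(K\cap\{\xi,\nu\}^\perp)\,\mathrm{Vol}_n(K)}.$$
   Context: $\xi^\perp$ is the hyperplane through the origin orthogonal to $\xi$; $\{\xi,\nu\}^\perp$ is the subspace of codimension $2$ orthogonal to both $\xi$ and $\nu$. $\mathrm{Vol}_m$ is $m$-dimensional Lebesgue measure (with $\mathrm{Vol}_0$ of a point equal to $1$). A convex body is a compact convex set with non-empty interior. *)

theory Defs
  imports "HOL-Analysis.Analysis"
begin

text \<open>
  The dimension is quantified inside the statement, so \<open>\<real>\<^sup>n\<close> is the library's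
  \<^term>\<open>Euclidean_space n\<close>: the sequences \<open>nat \<Rightarrow> real\<close> vanishing from index \<open>n\<close> on.
  The sphere \<open>S\<^sup>n\<^sup>-\<^sup>1\<close> is \<^term>\<open>nsphere (n - 1)\<close>.
\<close>

abbreviation Rn :: "nat \<Rightarrow> (nat \<Rightarrow> real) set" where
  "Rn n \<equiv> topspace (Euclidean_space n)"

definition dotp :: "nat \<Rightarrow> (nat \<Rightarrow> real) \<Rightarrow> (nat \<Rightarrow> real) \<Rightarrow> real" where
  "dotp n x y = (\<Sum>i<n. x i * y i)"

definition perp :: "nat \<Rightarrow> (nat \<Rightarrow> real) set \<Rightarrow> (nat \<Rightarrow> real) set" where
  "perp n S = {x \<in> Rn n. \<forall>v\<in>S. dotp n x v = 0}"

definition convex_body :: "nat \<Rightarrow> (nat \<Rightarrow> real) set \<Rightarrow> bool" where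
  "convex_body n K \<longleftrightarrow>
     compactin (Euclidean_space n) K \<and>
     (\<forall>x\<in>K. \<forall>y\<in>K. \<forall>u\<ge>0. \<forall>v\<ge>0. u + v = 1 \<longrightarrow> (\<lambda>i. u * x i + v * y i) \<in> K) \<and>
     Euclidean_space n interior_of K \<noteq> {}"

definition origin_symmetric :: "(nat \<Rightarrow> real) set \<Rightarrow> bool" where
  "origin_symmetric K \<longleftrightarrow> (\<forall>x\<in>K. (\<lambda>i. - x i) \<in> K)"

text \<open>
  Lebesgue measure of \<open>A \<subseteq> \<real>\<^sup>n\<close>. The product measure lives on functions that are
  \<^term>\<open>undefined\<close> outside \<open>{..<n}\<close>, and \<open>restrict\<close> is the bijection from \<^term>\<open>Rn n\<close>
  onto that space. For \<open>n = 0\<close> the single point has measure 1.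
\<close>

definition vol :: "nat \<Rightarrow> (nat \<Rightarrow> real) set \<Rightarrow> real" where
  "vol n A = measure (completion (\<Pi>\<^sub>M i\<in>{..<n}. lborel)) ((\<lambda>x. restrict x {..<n}) ` A)"

definition lincomb :: "nat \<Rightarrow> (nat \<Rightarrow> nat \<Rightarrow> real) \<Rightarrow> (nat \<Rightarrow> real) \<Rightarrow> (nat \<Rightarrow> real)" where
  "lincomb m u t = (\<lambda>i. \<Sum>j<m. t j * u j i)"

definition orthonormal_basis ::
  "nat \<Rightarrow> nat \<Rightarrow> (nat \<Rightarrow> nat \<Rightarrow> real) \<Rightarrow> (nat \<Rightarrow> real) set \<Rightarrow> bool" where
  "orthonormal_basis n m u V \<longleftrightarrow>
     (\<forall>i<m. \<forall>j<m. dotp n (u i) (u j) = (if i = j then 1 else 0)) \<and>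
     V = range (lincomb m u)"

text \<open>
  The \<open>m\<close>-dimensional Lebesgue measure on an \<open>m\<close>-dimensional linear subspace \<open>V\<close> of
  \<open>\<real>\<^sup>n\<close>: coordinates with respect to an orthonormal basis of \<open>V\<close> identify \<open>V\<close>
  isometrically with \<open>\<real>\<^sup>m\<close>. The choice of the basis is immaterial because Lebesgue
  measure is invariant under orthogonal maps.
\<close>

definition subspace_vol :: "nat \<Rightarrow> nat \<Rightarrow> (nat \<Rightarrow> real) set \<Rightarrow> (nat \<Rightarrow> real) set \<Rightarrow> real" where
  "subspace_vol n m V A =
     (let u = (SOME u. orthonormal_basis n m u V) in vol m {t \<in> Rn m. lincomb m u t \<in> A})"

end

theory Submission
  imports Defs "HOL-Probability.Probability"
begin

text \<open>
  Fix the codimension-two subspace \<open>H\<close> of the first \<open>n - 2\<close> coordinates and let \<open>G(a, b)\<close> be the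
  volume of the section of \<open>K\<close> by the translate of \<open>H\<close> through \<open>(0, a, b)\<close>. By the
  Prekopa-Leindler inequality \<open>G\<close> is log-concave, so \<open>G(0) G(z) \<le> G(l z) G((1 - l) z)\<close>. Integrating
  this along the line of slope \<open>t\<close> gives \<open>G(0) \<integral> \<bar>x\<bar> G(x, t x) dx \<le> (\<integral> G(x, t x) dx)\<^sup>2\<close>. The right-hand
  side is \<open>S(t)\<^sup>2 / (1 + t\<^sup>2)\<close>, where \<open>S(t)\<close> is the volume of the section of \<open>K\<close> by the hyperplane
  spanned by \<open>H\<close> and that line, and integrating the left-hand side over \<open>t\<close> gives \<open>G(0) vol(K)\<close>.
  Hence \<open>G(0) vol(K) \<le> \<pi> sup S\<^sup>2\<close>, and \<open>\<pi> < 4\<close> allows \<open>c = 1/2\<close>.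
\<close>

section \<open>Lebesgue measure on coordinates\<close>

text \<open>The weight \<open>\<bar>x\<bar>\<close> is what makes the two integrations fit together.
  Along one line it is the length of the segment from 0 to x, which enters when G restricted to the
  line is convolved with itself; over all slopes it is the Jacobian of y = t x. The bound on each
  line is therefore exactly the integrand that recovers the volume. Parametrising a line by x
  instead of arc length costs \<open>sqrt (1 + t\<^sup>2)\<close>; squared, this gives a weight
  whose integral over all slopes is pi. Turning an orthonormal pair of vectors inside the plane of
  the last two coordinates does not move the subspace orthogonal to both. Hence G(0) is the same for
  every slope, and only the hyperplane has to be chosen. Since \<open>subspace_vol\<close> uses an
  unspecified orthonormal basis, invariance of Lebesgue measure under orthogonal maps has to come
  before any computation with it.\<close>

interpretation lebesgue_product: product_sigma_finite "\<lambda>_::nat. lborel :: real measure"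
  by standard

abbreviation lebesgue_on_coords :: "nat set \<Rightarrow> (nat \<Rightarrow> real) measure"
  where "lebesgue_on_coords I \<equiv> \<Pi>\<^sub>M i\<in>I. lborel"

lemma pair_sigma_finite_lebesgue_on_coords:
  "finite I \<Longrightarrow> finite J \<Longrightarrow> pair_sigma_finite (lebesgue_on_coords I) (lebesgue_on_coords J)"
  by (simp add: lebesgue_product.sigma_finite pair_sigma_finite.intro)

text \<open>A product measure is determined by its values on boxes, and the map acts on each side of
  a box separately. The sign \<open>e\<close> covers both substitutions needed for orthogonal
  invariance: translation and the reflection of x to a - x.\<close>

lemma nn_integral_lebesgue_on_coords_reflect_translate:
  fixes a :: "nat \<Rightarrow> real" and e :: real
  assumes I: "finite I" and e: "\<bar>e\<bar> = 1"
    and f[measurable]: "f \<in> borel_measurable (lebesgue_on_coords I)"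
  shows "(\<integral>\<^sup>+x. f (\<lambda>i\<in>I. a i + e * x i) \<partial>lebesgue_on_coords I) = integral\<^sup>N (lebesgue_on_coords I) f"
proof -
  let ?L = "lebesgue_on_coords I" and ?T = "\<lambda>x. \<lambda>i\<in>I. a i + e * x i"
  have T[measurable]: "?T \<in> measurable ?L ?L" by measurable
  have e0: "e \<noteq> 0" using e by auto
  have "distr ?L ?L ?T = ?L"
  proof (rule lebesgue_product.PiM_eqI[OF I])
    fix A assume A: "\<And>i. i \<in> I \<Longrightarrow> A i \<in> sets (lborel :: real measure)"
    have m: "(\<lambda>x. a i + e * x) -` A i \<in> sets lborel" if "i \<in> I" for i
      using measurable_sets_borel[of "\<lambda>x. a i + e * x" borel "A i"] A[OF that] by simp
    have lb: "emeasure lborel ((\<lambda>x. a i + e * x) -` A i) = emeasure lborel (A i)" if "i \<in> I" for i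
    proof -
      have "emeasure lborel (A i) = (\<integral>\<^sup>+x. indicator (A i) x \<partial>lborel)"
        using A[OF that] by simp
      also have "\<dots> = (\<integral>\<^sup>+x. indicator (A i) (a i + e * x) \<partial>lborel)"
        using A[OF that] by (subst nn_integral_real_affine[OF _ e0, where t="a i"]) (auto simp: e)
      also have "\<dots> = (\<integral>\<^sup>+x. indicator ((\<lambda>x. a i + e * x) -` A i) x \<partial>lborel)"
        by (simp add: indicator_vimage)
      finally show ?thesis using m[OF that] by simp
    qed
    have "emeasure (distr ?L ?L ?T) (Pi\<^sub>E I A) = emeasure ?L (?T -` Pi\<^sub>E I A \<inter> space ?L)"
      using A I by (intro emeasure_distr) (auto intro!: sets_PiM_I_finite)
    also have "?T -` Pi\<^sub>E I A \<inter> space ?L = Pi\<^sub>E I (\<lambda>i. (\<lambda>x. a i + e * x) -` A i)"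
      by (auto simp: space_PiM PiE_iff)
    also have "emeasure ?L \<dots> = (\<Prod>i\<in>I. emeasure lborel ((\<lambda>x. a i + e * x) -` A i))"
      using I m by (intro lebesgue_product.emeasure_PiM) auto
    also have "\<dots> = (\<Prod>i\<in>I. emeasure lborel (A i))"
      using lb by (intro prod.cong) auto
    finally show "emeasure (distr ?L ?L ?T) (Pi\<^sub>E I A) = (\<Prod>i\<in>I. emeasure lborel (A i))" .
  qed simp
  then have "integral\<^sup>N ?L f = integral\<^sup>N (distr ?L ?L ?T) f" by simp
  also have "\<dots> = (\<integral>\<^sup>+x. f (?T x) \<partial>?L)"
    by (intro nn_integral_distr) auto
  finally show ?thesis by simp
qed

text \<open>
  The pushforward of Lebesgue measure under an orthogonal map is translation invariant. Comparing it
  with Lebesgue measure by Fubini against a rotation invariant probability density, here the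
  Gaussian, shows that the two agree.
\<close>

lemma nn_integral_lebesgue_on_coords_orthogonal:
  fixes T :: "nat \<Rightarrow> nat \<Rightarrow> real"
  assumes o1: "\<And>i j. i < m \<Longrightarrow> j < m \<Longrightarrow> (\<Sum>k<m. T i k * T j k) = (if i = j then 1 else 0)"
    and o2: "\<And>i j. i < m \<Longrightarrow> j < m \<Longrightarrow> (\<Sum>k<m. T k i * T k j) = (if i = j then 1 else 0)"
    and f[measurable]: "f \<in> borel_measurable (lebesgue_on_coords {..<m})"
  shows "(\<integral>\<^sup>+x. f (\<lambda>i\<in>{..<m}. \<Sum>j<m. T i j * x j) \<partial>lebesgue_on_coords {..<m})
    = integral\<^sup>N (lebesgue_on_coords {..<m}) f"
proof -
  let ?L = "lebesgue_on_coords {..<m}"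
  define U where "U = (\<lambda>x. \<lambda>i\<in>{..<m}. \<Sum>j<m. T i j * x j)"
  define V where "V = (\<lambda>x. \<lambda>i\<in>{..<m}. \<Sum>j<m. T j i * x j)"
  define g :: "(nat \<Rightarrow> real) \<Rightarrow> ennreal" where "g = (\<lambda>x. \<Prod>i<m. ennreal (std_normal_density (x i)))"
  have U[measurable]: "U \<in> measurable ?L ?L" unfolding U_def by measurable
  have V[measurable]: "V \<in> measurable ?L ?L" unfolding V_def by measurable
  have g[measurable]: "g \<in> borel_measurable ?L" unfolding g_def by measurable
  have ig: "integral\<^sup>N ?L g = 1"
  proof -
    have "(\<integral>\<^sup>+x. ennreal (std_normal_density x) \<partial>lborel) = 1"
      using integral_normal_density[of 1 0] integrable_normal_density[of 1 0]
      by (subst nn_integral_eq_integral) auto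
    then show ?thesis unfolding g_def
      by (subst lebesgue_product.product_nn_integral_prod) auto
  qed
  have g_eq: "g x = ennreal ((1 / sqrt (2 * pi)) ^ m * exp (- (\<Sum>i<m. (x i)\<^sup>2) / 2))" for x
  proof -
    have "g x = ennreal (\<Prod>i<m. (1 / sqrt (2 * pi)) * exp (- (x i)\<^sup>2 / 2))"
      unfolding g_def by (simp add: prod_ennreal std_normal_density_def)
    also have "(\<Prod>i<m. (1 / sqrt (2 * pi)) * exp (- (x i)\<^sup>2 / 2))
        = (1 / sqrt (2 * pi)) ^ m * exp (\<Sum>i<m. - (x i)\<^sup>2 / 2)"
      by (subst prod.distrib) (simp add: exp_sum)
    finally show ?thesis by (simp add: sum_negf sum_divide_distrib)
  qed
  have UV: "U (V y) i = y i" if "i < m" for y i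
  proof -
    have "U (V y) i = (\<Sum>j<m. \<Sum>k<m. T i j * T k j * y k)"
      using that by (simp add: U_def V_def sum_distrib_left mult.assoc)
    also have "\<dots> = (\<Sum>k<m. (\<Sum>j<m. T i j * T k j) * y k)"
      by (subst sum.swap) (simp add: sum_distrib_right)
    also have "\<dots> = (\<Sum>k<m. if k = i then y k else 0)"
      using that by (intro sum.cong) (auto simp: o1)
    finally show ?thesis using that by simp
  qed
  have norm_U: "(\<Sum>i<m. (U x i)\<^sup>2) = (\<Sum>i<m. (x i)\<^sup>2)" for x
  proof -
    have "(\<Sum>i<m. (U x i)\<^sup>2) = (\<Sum>i<m. \<Sum>j<m. \<Sum>k<m. (T i j * T i k) * (x j * x k))"
      by (simp add: U_def power2_eq_square sum_product algebra_simps)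
    also have "\<dots> = (\<Sum>j<m. \<Sum>k<m. \<Sum>i<m. (T i j * T i k) * (x j * x k))"
      by (subst sum.swap) (intro sum.cong refl sum.swap)
    also have "\<dots> = (\<Sum>j<m. \<Sum>k<m. if k = j then x j * x k else 0)"
      by (intro sum.cong refl) (auto simp: o2 simp flip: sum_distrib_right)
    finally show ?thesis by (simp add: power2_eq_square)
  qed
  have g_cong: "g x = g y" if "\<And>i. i < m \<Longrightarrow> x i = y i" for x y
    unfolding g_def using that by simp
  interpret pair_sigma_finite ?L ?L by (rule pair_sigma_finite_lebesgue_on_coords) auto
  have tr: "(\<integral>\<^sup>+x. h (\<lambda>i\<in>{..<m}. a i + x i) \<partial>?L) = integral\<^sup>N ?L h"
    if "h \<in> borel_measurable ?L" for h :: "_ \<Rightarrow> ennreal" and a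
    using nn_integral_lebesgue_on_coords_reflect_translate[of "{..<m}" 1 h a] that by simp
  have rf: "(\<integral>\<^sup>+x. h (\<lambda>i\<in>{..<m}. a i - x i) \<partial>?L) = integral\<^sup>N ?L h"
    if "h \<in> borel_measurable ?L" for h :: "_ \<Rightarrow> ennreal" and a
    using nn_integral_lebesgue_on_coords_reflect_translate[of "{..<m}" "-1" h a] that by simp
  \<comment> \<open>Since \<open>f\<close> is arbitrary, this must be an equality of functions,
    including the value \<open>undefined\<close> from index \<open>m\<close> on. The density
    \<open>g\<close> sees only the coordinates below \<open>m\<close>, so for it \<open>Usub\<close>
    is enough.\<close>
  have Uadd: "U (\<lambda>i\<in>{..<m}. V y i + x i) = (\<lambda>i\<in>{..<m}. y i + U x i)" for x y
  proof -
    have "U (\<lambda>i\<in>{..<m}. V y i + x i) i = U (V y) i + U x i" if "i < m" for i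
      using that by (simp add: U_def sum.distrib algebra_simps)
    moreover have "U (\<lambda>i\<in>{..<m}. V y i + x i) i = undefined" if "\<not> i < m" for i
      using that by (simp add: U_def)
    ultimately show ?thesis using UV by (auto simp: fun_eq_iff)
  qed
  have Usub: "U (\<lambda>i\<in>{..<m}. V y i - x i) i = y i - U x i" if "i < m" for x y i
  proof -
    have "U (\<lambda>i\<in>{..<m}. V y i - x i) i = U (V y) i - U x i"
      using that by (simp add: U_def sum_subtractf algebra_simps)
    then show ?thesis using UV that by simp
  qed
  have gU: "g (\<lambda>i\<in>{..<m}. y i - U x i) = g (\<lambda>i\<in>{..<m}. V y i - x i)" for x y
  proof -
    have "g (\<lambda>i\<in>{..<m}. y i - U x i) = g (U (\<lambda>i\<in>{..<m}. V y i - x i))"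
      by (intro g_cong) (simp add: Usub)
    then show ?thesis by (simp only: g_eq norm_U)
  qed
  have Ufst: "(\<lambda>p. U (fst p)) \<in> measurable (?L \<Otimes>\<^sub>M ?L) ?L"
    by (rule measurable_compose[OF measurable_fst U])
  have comps: "(\<lambda>p. U (fst p) i) \<in> borel_measurable (?L \<Otimes>\<^sub>M ?L)"
    "(\<lambda>p. snd p i) \<in> borel_measurable (?L \<Otimes>\<^sub>M ?L)" if "i < m" for i
    using that measurable_compose[OF Ufst measurable_component_singleton[of i]]
      measurable_compose[OF measurable_snd measurable_component_singleton[of i]] by auto
  have sums: "(\<lambda>p. \<lambda>i\<in>{..<m}. snd p i + U (fst p) i) \<in> measurable (?L \<Otimes>\<^sub>M ?L) ?L"
    "(\<lambda>p. \<lambda>i\<in>{..<m}. snd p i - U (fst p) i) \<in> measurable (?L \<Otimes>\<^sub>M ?L) ?L"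
    using comps by (auto intro!: measurable_restrict)
  note joint = borel_measurable_times_ennreal
    measurable_compose[OF measurable_snd f] measurable_compose[OF measurable_snd g]
    measurable_compose[OF Ufst f] measurable_compose[OF sums(1) f] measurable_compose[OF sums(2) g]
  have "(\<integral>\<^sup>+x. f (U x) \<partial>?L) = (\<integral>\<^sup>+x. \<integral>\<^sup>+y. f (U x) * g y \<partial>?L \<partial>?L)"
    by (simp add: nn_integral_cmult ig)
  also have "\<dots> = (\<integral>\<^sup>+y. \<integral>\<^sup>+x. f (U x) * g y \<partial>?L \<partial>?L)"
    by (intro Fubini'[symmetric]) (simp add: split_beta' joint)
  \<comment> \<open>Shifting x by \<open>V y\<close>, the preimage of y, adds y to
    \<open>U x\<close>. After the order of integration is exchanged, y is shifted by
    \<open>- U x\<close>, which moves the dependence on \<open>U\<close> from \<open>f\<close> to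
    \<open>g\<close>.\<close>
  also have "\<dots> = (\<integral>\<^sup>+y. \<integral>\<^sup>+x. f (U (\<lambda>i\<in>{..<m}. V y i + x i)) * g y \<partial>?L \<partial>?L)"
    by (intro nn_integral_cong tr[symmetric]) measurable
  also have "\<dots> = (\<integral>\<^sup>+y. \<integral>\<^sup>+x. f (\<lambda>i\<in>{..<m}. y i + U x i) * g y \<partial>?L \<partial>?L)"
    by (simp only: Uadd)
  also have "\<dots> = (\<integral>\<^sup>+x. \<integral>\<^sup>+y. f (\<lambda>i\<in>{..<m}. y i + U x i) * g y \<partial>?L \<partial>?L)"
    by (intro Fubini') (simp add: split_beta' joint)
  also have "\<dots> = (\<integral>\<^sup>+x. \<integral>\<^sup>+y. f y * g (\<lambda>i\<in>{..<m}. y i - U x i) \<partial>?L \<partial>?L)"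
  proof (rule nn_integral_cong)
    fix x assume "x \<in> space ?L"
    have "(\<integral>\<^sup>+y. f y * g (\<lambda>i\<in>{..<m}. y i - U x i) \<partial>?L)
      = (\<integral>\<^sup>+y. f (\<lambda>i\<in>{..<m}. U x i + y i) * g (\<lambda>i\<in>{..<m}. (\<lambda>i\<in>{..<m}. U x i + y i) i - U x i) \<partial>?L)"
      by (intro tr[symmetric]) measurable
    also have "\<dots> = (\<integral>\<^sup>+y. f (\<lambda>i\<in>{..<m}. y i + U x i) * g y \<partial>?L)"
      by (intro nn_integral_cong arg_cong2[where f="(*)"] g_cong) (auto simp: add.commute)
    finally show "(\<integral>\<^sup>+y. f (\<lambda>i\<in>{..<m}. y i + U x i) * g y \<partial>?L)
      = (\<integral>\<^sup>+y. f y * g (\<lambda>i\<in>{..<m}. y i - U x i) \<partial>?L)" ..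
  qed
  also have "\<dots> = (\<integral>\<^sup>+y. \<integral>\<^sup>+x. f y * g (\<lambda>i\<in>{..<m}. y i - U x i) \<partial>?L \<partial>?L)"
    by (intro Fubini'[symmetric]) (simp add: split_beta' joint)
  \<comment> \<open>By rotation invariance of \<open>g\<close> the map disappears from the inner
    integral, which is then the total mass 1 after a reflection.\<close>
  also have "\<dots> = (\<integral>\<^sup>+y. f y * (\<integral>\<^sup>+x. g (\<lambda>i\<in>{..<m}. V y i - x i) \<partial>?L) \<partial>?L)"
    by (intro nn_integral_cong) (simp add: gU nn_integral_cmult)
  also have "\<dots> = (\<integral>\<^sup>+y. f y \<partial>?L)"
    by (simp add: rf ig)
  finally show ?thesis unfolding U_def .
qed

section \<open>The Brunn-Minkowski inequality on the line\<close>

text \<open>Continuity of measure needs a sequence inside A, while A may be unbounded or miss its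
  supremum. If there is no maximum, choose for each rational an element of A above it whenever one
  exists, and take running maxima.\<close>

lemma ex_cofinal_incseq:
  fixes A :: "real set"
  assumes "A \<noteq> {}"
  obtains s :: "nat \<Rightarrow> real" where "\<And>k. s k \<in> A" "incseq s" "\<And>x. x \<in> A \<Longrightarrow> \<exists>k. x \<le> s k"
proof (cases "\<exists>a\<in>A. \<forall>x\<in>A. x \<le> a")
  case True
  then obtain a where "a \<in> A" "\<forall>x\<in>A. x \<le> a" by blast
  then show ?thesis by (intro that[of "\<lambda>_. a"]) auto
next
  case False
  obtain a0 where a0: "a0 \<in> A" using assms by blast
  define q :: "nat \<Rightarrow> real" where "q k = of_rat (nat_to_rat_surj k)" for k
  define t where "t k = (if \<exists>a\<in>A. q k \<le> a then SOME a. a \<in> A \<and> q k \<le> a else a0)" for k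
  have t: "t k \<in> A" "(\<exists>a\<in>A. q k \<le> a) \<Longrightarrow> q k \<le> t k" for k
  proof -
    have "t k \<in> A \<and> q k \<le> t k" if "\<exists>a\<in>A. q k \<le> a"
    proof -
      have "\<exists>a. a \<in> A \<and> q k \<le> a" using that by blast
      from someI_ex[OF this] show ?thesis using that by (simp only: t_def if_True)
    qed
    moreover have "t k \<in> A" if "\<not> (\<exists>a\<in>A. q k \<le> a)"
      using that a0 by (simp only: t_def if_False)
    ultimately show "t k \<in> A" "(\<exists>a\<in>A. q k \<le> a) \<Longrightarrow> q k \<le> t k" by blast+
  qed
  define s where "s k = Max (t ` {..k})" for k
  show ?thesis
  proof (rule that[of s])
    fix k have "s k \<in> t ` {..k}" unfolding s_def by (intro Max_in) auto
    then show "s k \<in> A" using t by auto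
  next
    show "incseq s" unfolding s_def by (intro monoI Max_mono) auto
  next
    fix x assume "x \<in> A"
    then obtain a where a: "a \<in> A" "x < a" using False by force
    obtain r where r: "x < of_rat r" "of_rat r < a" using of_rat_dense[OF a(2)] by blast
    obtain k where k: "r = nat_to_rat_surj k" using surj_nat_to_rat_surj by (metis surjD)
    have "x \<le> t k" using t(2)[of k] r a k by (force simp: q_def)
    also have "t k \<le> s k" unfolding s_def by (intro Max_ge) auto
    finally show "\<exists>k. x \<le> s k" by blast
  qed
qed

text \<open>The cut points are taken in A itself because in the Brunn-Minkowski argument the cut
  point also serves as a summand.\<close>

lemma emeasure_eq_SUP_initial_segments:
  fixes A :: "real set"
  assumes A[measurable]: "A \<in> sets borel"
  shows "emeasure lborel A = (SUP a\<in>A. emeasure lborel (A \<inter> {..a}))"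
proof (cases "A = {}")
  case False
  obtain s where s: "\<And>k. s k \<in> A" "incseq s" "\<And>x. x \<in> A \<Longrightarrow> \<exists>k. x \<le> s k"
    using ex_cofinal_incseq[OF False] by metis
  have eq: "(\<Union>k::nat. A \<inter> {..s k}) = A" using s(3) by auto
  have "(SUP k. emeasure lborel (A \<inter> {..s k})) = emeasure lborel (\<Union>k. A \<inter> {..s k})"
  proof (rule SUP_emeasure_incseq)
    show "incseq (\<lambda>k. A \<inter> {..s k})"
      using s(2) by (auto simp: incseq_def intro: order_trans)
  qed auto
  then have "emeasure lborel A = (SUP k. emeasure lborel (A \<inter> {..s k}))" by (simp only: eq)
  also have "\<dots> \<le> (SUP a\<in>A. emeasure lborel (A \<inter> {..a}))"
    using s(1) by (intro SUP_mono) auto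
  finally show ?thesis
    by (intro antisym SUP_least emeasure_mono) auto
qed (simp add: bot_ennreal)

lemma emeasure_eq_SUP_final_segments:
  fixes A :: "real set"
  assumes A[measurable]: "A \<in> sets borel"
  shows "emeasure lborel A = (SUP a\<in>A. emeasure lborel (A \<inter> {a..}))"
proof -
  have mirror: "emeasure lborel (uminus -` S) = emeasure lborel S" if "S \<in> sets borel" for S :: "real set"
    using that emeasure_distr[of "uminus" lborel borel S] lborel_distr_uminus by simp
  have m: "uminus -` A \<in> sets borel"
    using measurable_sets_borel[of uminus borel A] by simp
  have "emeasure lborel A = (SUP a\<in>uminus -` A. emeasure lborel (uminus -` A \<inter> {..a}))"
    using emeasure_eq_SUP_initial_segments[OF m] mirror[OF A] by simp
  also have "\<dots> = (SUP a\<in>uminus -` A. emeasure lborel (A \<inter> {-a..}))"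
  proof (intro SUP_cong refl)
    fix a :: real
    have "uminus -` A \<inter> {..a} = uminus -` (A \<inter> {-a..})" by auto
    then show "emeasure lborel (uminus -` A \<inter> {..a}) = emeasure lborel (A \<inter> {-a..})"
      using mirror[of "A \<inter> {-a..}"] by simp
  qed
  also have "\<dots> = (SUP a\<in>A. emeasure lborel (A \<inter> {a..}))"
  proof (rule SUP_eq)
    fix a assume "a \<in> uminus -` A"
    then show "\<exists>b\<in>A. emeasure lborel (A \<inter> {-a..}) \<le> emeasure lborel (A \<inter> {b..})"
      by (intro bexI[of _ "-a"]) auto
  next
    fix b assume "b \<in> A"
    then show "\<exists>a\<in>uminus -` A. emeasure lborel (A \<inter> {b..}) \<le> emeasure lborel (A \<inter> {-a..})"
      by (intro bexI[of _ "-b"]) auto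
  qed
  finally show ?thesis .
qed

lemma emeasure_lborel_affine_vimage:
  fixes A :: "real set"
  assumes [measurable]: "A \<in> sets borel" and "c > 0"
  shows "emeasure lborel ((\<lambda>z. (z - t) / c) -` A) = ennreal c * emeasure lborel A"
proof -
  let ?D = "(\<lambda>z. (z - t) / c) -` A"
  have D: "?D \<in> sets borel" using measurable_sets_borel[of "\<lambda>z. (z - t) / c" borel A] by simp
  have "emeasure lborel ?D = (\<integral>\<^sup>+z. indicator ?D z \<partial>lborel)" using D by simp
  also have "\<dots> = ennreal \<bar>c\<bar> * (\<integral>\<^sup>+x. indicator ?D (t + c * x) \<partial>lborel)"
    using D assms by (intro nn_integral_real_affine) auto
  also have "(\<lambda>x. indicator ?D (t + c * x) :: ennreal) = indicator A"
    using assms by (auto simp: indicator_def)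
  finally show ?thesis using assms by simp
qed

text \<open>
  The translates of \<open>(1 - l) A\<close> by \<open>l b\<close> and of \<open>l B\<close> by \<open>(1 - l) a\<close> both lie in the Minkowski
  combination; cutting \<open>A\<close> above \<open>a\<close> and \<open>B\<close> below \<open>b\<close> makes them meet in one point only.
\<close>

lemma brunn_minkowski_real:
  fixes A B C :: "real set" and l :: real
  assumes l: "0 < l" "l < 1" and ne: "A \<noteq> {}" "B \<noteq> {}"
    and m[measurable]: "A \<in> sets borel" "B \<in> sets borel" "C \<in> sets borel"
    and C: "\<And>x y. x \<in> A \<Longrightarrow> y \<in> B \<Longrightarrow> (1 - l) * x + l * y \<in> C"
  shows "ennreal (1 - l) * emeasure lborel A + ennreal l * emeasure lborel B \<le> emeasure lborel C"
proof -
  have seg: "ennreal (1 - l) * emeasure lborel (A \<inter> {..a}) + ennreal l * emeasure lborel (B \<inter> {b..})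
      \<le> emeasure lborel C" if a: "a \<in> A" and b: "b \<in> B" for a b
  proof -
    define p where "p = (1 - l) * a + l * b"
    define D1 where "D1 = (\<lambda>z. (z - l * b) / (1 - l)) -` (A \<inter> {..a})"
    define D2 where "D2 = (\<lambda>z. (z - (1 - l) * a) / l) -` (B \<inter> {b..})"
    have [measurable]: "D1 \<in> sets borel" "D2 \<in> sets borel"
      unfolding D1_def D2_def
      using measurable_sets_borel[of "\<lambda>z. (z - l * b) / (1 - l)" borel "A \<inter> {..a}"]
        measurable_sets_borel[of "\<lambda>z. (z - (1 - l) * a) / l" borel "B \<inter> {b..}"] by simp_all
    have D1: "z \<in> C \<and> z \<le> p" if "z \<in> D1" for z
    proof -
      define w where "w = (z - l * b) / (1 - l)"
      have "z = (1 - l) * w + l * b" using l by (simp add: w_def)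
      moreover have "w \<in> A" "w \<le> a" using that by (auto simp: D1_def w_def)
      ultimately show ?thesis using C[of w b] b l by (simp add: p_def)
    qed
    have D2: "z \<in> C \<and> p \<le> z" if "z \<in> D2" for z
    proof -
      define w where "w = (z - (1 - l) * a) / l"
      have "z = (1 - l) * a + l * w" using l by (simp add: w_def)
      moreover have "w \<in> B" "b \<le> w" using that by (auto simp: D2_def w_def)
      ultimately show ?thesis using C[of a w] a l by (simp add: p_def)
    qed
    have "ennreal (1 - l) * emeasure lborel (A \<inter> {..a}) + ennreal l * emeasure lborel (B \<inter> {b..})
      = emeasure lborel D1 + emeasure lborel D2"
      unfolding D1_def D2_def using l
      by (subst (1 2) emeasure_lborel_affine_vimage) auto
    also have "emeasure lborel D2 = emeasure lborel (D2 - {p})"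
      by (intro emeasure_Diff_null_set[symmetric]) auto
    also have "emeasure lborel D1 + \<dots> = emeasure lborel (D1 \<union> (D2 - {p}))"
      using D1 D2 by (intro plus_emeasure) (force+)
    also have "\<dots> \<le> emeasure lborel C" using D1 D2 by (intro emeasure_mono) auto
    finally show ?thesis .
  qed
  have "ennreal (1 - l) * emeasure lborel A + ennreal l * emeasure lborel B
    = (SUP a\<in>A. ennreal (1 - l) * emeasure lborel (A \<inter> {..a}))
      + (SUP b\<in>B. ennreal l * emeasure lborel (B \<inter> {b..}))"
    by (subst emeasure_eq_SUP_initial_segments[OF m(1)], subst emeasure_eq_SUP_final_segments[OF m(2)])
       (simp add: SUP_mult_left_ennreal)
  also have "\<dots> = (SUP b\<in>B. SUP a\<in>A. ennreal (1 - l) * emeasure lborel (A \<inter> {..a})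
      + ennreal l * emeasure lborel (B \<inter> {b..}))"
    using ne by (simp add: ennreal_SUP_add_left ennreal_SUP_add_right)
  also have "\<dots> \<le> emeasure lborel C"
    by (intro SUP_least seg)
  finally show ?thesis .
qed

section \<open>The Prekopa-Leindler inequality\<close>

text \<open>One half of the layer-cake formula. Levels are written \<open>u * W\<close> with u in
  the unit interval so that functions of different heights share the parameter u. Ignoring the
  levels above \<open>W\<close> only loses mass, so no bound on \<open>y\<close> enters
  here.\<close>

lemma nn_integral_superlevel_le:
  fixes y :: ennreal and W :: real
  assumes W: "W > 0"
  shows "(\<integral>\<^sup>+u. ennreal W * (if 0 < u \<and> u < 1 \<and> ennreal (u * W) \<le> y then 1 else 0) \<partial>lborel) \<le> y"
proof (cases y)
  case (real r)
  have "(\<integral>\<^sup>+u. ennreal W * (if 0 < u \<and> u < 1 \<and> ennreal (u * W) \<le> y then 1 else 0) \<partial>lborel)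
    \<le> (\<integral>\<^sup>+u. ennreal W * indicator {0..r / W} u \<partial>lborel)"
    using real W by (intro nn_integral_mono) (auto simp: indicator_def field_simps)
  also have "\<dots> = ennreal W * ennreal (r / W)"
    using real W by (simp add: nn_integral_cmult)
  finally show ?thesis using real W by (simp flip: ennreal_mult')
qed simp

text \<open>The other half: since \<open>y\<close> is at most \<open>W\<close>, no level is missed
  by stopping at u = 1. Strict levels here and weak ones in the previous half match the strict
  premises and the weak conclusion of the Prekopa-Leindler hypothesis.\<close>

lemma nn_integral_superlevel_ge:
  fixes y :: ennreal and W :: real
  assumes W: "W > 0" and y: "y \<le> ennreal W"
  shows "y \<le> (\<integral>\<^sup>+u. ennreal W * (if 0 < u \<and> u < 1 \<and> ennreal (u * W) < y then 1 else 0) \<partial>lborel)"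
proof (cases y)
  case (real r)
  have "r \<le> W" using real y W by simp
  then have "x < 1" if "x * W < r" for x using that W by (metis less_le_trans mult_1 mult_less_cancel_right_pos)
  have "y = ennreal W * ennreal (r / W)" using real W by (simp flip: ennreal_mult')
  also have "\<dots> = (\<integral>\<^sup>+u. ennreal W * indicator {0<..<r / W} u \<partial>lborel)"
    using real W by (simp add: nn_integral_cmult)
  also have "\<dots> \<le> (\<integral>\<^sup>+u. ennreal W * (if 0 < u \<and> u < 1 \<and> ennreal (u * W) < y then 1 else 0) \<partial>lborel)"
    using real W \<open>\<And>x. x * W < r \<Longrightarrow> x < 1\<close>
    by (intro nn_integral_mono) (auto simp: indicator_def ennreal_less_iff field_simps)
  finally show ?thesis .
qed (use y in \<open>auto simp: top_unique\<close>)

text \<open>Brunn-Minkowski requires nonempty sets, so f and g are measured against their suprema A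
  and B: for every fraction u < 1 both superlevel sets are then nonempty, and their combination lies
  in the superlevel set of h at u times \<open>A powr (1 - l) * B powr l\<close>. Integrating over u
  bounds the normalised integral of h below by a weighted arithmetic mean, hence by the geometric
  mean. Boundedness keeps A and B finite.\<close>

lemma prekopa_leindler_real_bounded:
  fixes f g h :: "real \<Rightarrow> ennreal" and l a b :: real
  assumes l: "0 < l" "l < 1"
    and m[measurable]: "f \<in> borel_measurable borel" "g \<in> borel_measurable borel" "h \<in> borel_measurable borel"
    and bd: "\<And>x. f x \<le> ennreal N" "\<And>x. g x \<le> ennreal N"
    and fgh: "\<And>x y a b. 0 < a \<Longrightarrow> 0 < b \<Longrightarrow> ennreal a < f x \<Longrightarrow> ennreal b < g y \<Longrightarrow>
      ennreal (a powr (1 - l) * b powr l) \<le> h ((1 - l) * x + l * y)"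
    and a: "0 < a" "ennreal a < (\<integral>\<^sup>+x. f x \<partial>lborel)"
    and b: "0 < b" "ennreal b < (\<integral>\<^sup>+x. g x \<partial>lborel)"
  shows "ennreal (a powr (1 - l) * b powr l) \<le> (\<integral>\<^sup>+x. h x \<partial>lborel)"
proof -
  have sup: "\<exists>A>0. (SUP x. F x) = ennreal A"
    if F: "\<And>x. F x \<le> ennreal N" "0 < (\<integral>\<^sup>+x. F x \<partial>lborel)" for F :: "real \<Rightarrow> ennreal"
  proof -
    have "(SUP x. F x) \<le> ennreal N" using F(1) by (intro SUP_least) auto
    then have fin: "(SUP x. F x) \<noteq> \<top>" using le_less_trans[OF _ ennreal_less_top[of N]] by (simp only: less_top)
    moreover have "(SUP x. F x) \<noteq> 0"
    proof
      assume "(SUP x. F x) = 0"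
      then have "F x = 0" for x using SUP_upper[of x UNIV F] by simp
      then show False using F(2) by simp
    qed
    ultimately show ?thesis
      by (cases "SUP x. F x") (auto simp: less_le)
  qed
  obtain A where A: "A > 0" "(SUP x. f x) = ennreal A"
    using sup[OF bd(1)] a by (meson le_less_trans zero_le)
  obtain B where B: "B > 0" "(SUP x. g x) = ennreal B"
    using sup[OF bd(2)] b by (meson le_less_trans zero_le)
  define W where "W = A powr (1 - l) * B powr l"
  have W: "W > 0" using A B by (simp add: W_def)
  define p where "p u x = (if 0 < u \<and> u < 1 \<and> ennreal (u * A) < f x then 1 else 0 :: ennreal)" for u x :: real
  define q where "q u x = (if 0 < u \<and> u < 1 \<and> ennreal (u * B) < g x then 1 else 0 :: ennreal)" for u x :: real
  define r where "r u x = (if 0 < u \<and> u < 1 \<and> ennreal (u * W) \<le> h x then 1 else 0 :: ennreal)" for u x :: real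
  have [measurable]: "(\<lambda>(u, x). p u x) \<in> borel_measurable (lborel \<Otimes>\<^sub>M lborel)"
      "(\<lambda>(u, x). q u x) \<in> borel_measurable (lborel \<Otimes>\<^sub>M lborel)"
      "(\<lambda>(u, x). r u x) \<in> borel_measurable (lborel \<Otimes>\<^sub>M lborel)"
    unfolding p_def q_def r_def by measurable
  have cut: "ennreal (1 - l) * (\<integral>\<^sup>+x. p u x \<partial>lborel) + ennreal l * (\<integral>\<^sup>+x. q u x \<partial>lborel)
      \<le> (\<integral>\<^sup>+x. r u x \<partial>lborel)" for u
  proof (cases "0 < u \<and> u < 1")
    case True
    define P where "P = {x. ennreal (u * A) < f x}"
    define Q where "Q = {x. ennreal (u * B) < g x}"
    define R where "R = {x. ennreal (u * W) \<le> h x}"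
    have [measurable]: "P \<in> sets borel" "Q \<in> sets borel" "R \<in> sets borel"
      unfolding P_def Q_def R_def by measurable
    have "ennreal (u * A) < (SUP x. f x)" "ennreal (u * B) < (SUP x. g x)"
      using True A B by (auto simp: ennreal_less_iff)
    then have ne: "P \<noteq> {}" "Q \<noteq> {}" by (auto simp: less_SUP_iff P_def Q_def)
    have uW: "(u * A) powr (1 - l) * (u * B) powr l = u * W"
    proof -
      have "u powr (1 - l) * u powr l = u" using True by (simp flip: powr_add)
      moreover have "(u * A) powr (1 - l) * (u * B) powr l = (u powr (1 - l) * u powr l) * W"
        using True A B by (simp add: powr_mult W_def)
      ultimately show ?thesis by simp
    qed
    have "(1 - l) * x + l * y \<in> R" if "x \<in> P" "y \<in> Q" for x y
      using that fgh[of "u * A" "u * B" x y] True A B by (simp add: P_def Q_def R_def uW)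
    then have "ennreal (1 - l) * emeasure lborel P + ennreal l * emeasure lborel Q \<le> emeasure lborel R"
      using l ne by (intro brunn_minkowski_real) auto
    moreover have "p u = indicator P" "q u = indicator Q" "r u = indicator R"
      using True by (auto simp: p_def q_def r_def P_def Q_def R_def indicator_def)
    ultimately show ?thesis by simp
  qed (auto simp: p_def q_def)
  have f_le: "(\<integral>\<^sup>+x. f x \<partial>lborel) \<le> ennreal A * (\<integral>\<^sup>+u. \<integral>\<^sup>+x. p u x \<partial>lborel \<partial>lborel)"
  proof -
    have "(\<integral>\<^sup>+x. f x \<partial>lborel) \<le> (\<integral>\<^sup>+x. \<integral>\<^sup>+u. ennreal A * p u x \<partial>lborel \<partial>lborel)"
      unfolding p_def using A SUP_upper[of _ UNIV f]
      by (intro nn_integral_mono nn_integral_superlevel_ge) auto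
    also have "\<dots> = (\<integral>\<^sup>+u. \<integral>\<^sup>+x. ennreal A * p u x \<partial>lborel \<partial>lborel)"
      by (intro lborel_pair.Fubini') measurable
    finally show ?thesis by (simp add: nn_integral_cmult)
  qed
  have g_le: "(\<integral>\<^sup>+x. g x \<partial>lborel) \<le> ennreal B * (\<integral>\<^sup>+u. \<integral>\<^sup>+x. q u x \<partial>lborel \<partial>lborel)"
  proof -
    have "(\<integral>\<^sup>+x. g x \<partial>lborel) \<le> (\<integral>\<^sup>+x. \<integral>\<^sup>+u. ennreal B * q u x \<partial>lborel \<partial>lborel)"
      unfolding q_def using B SUP_upper[of _ UNIV g]
      by (intro nn_integral_mono nn_integral_superlevel_ge) auto
    also have "\<dots> = (\<integral>\<^sup>+u. \<integral>\<^sup>+x. ennreal B * q u x \<partial>lborel \<partial>lborel)"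
      by (intro lborel_pair.Fubini') measurable
    finally show ?thesis by (simp add: nn_integral_cmult)
  qed
  have h_ge: "ennreal W * (\<integral>\<^sup>+u. \<integral>\<^sup>+x. r u x \<partial>lborel \<partial>lborel) \<le> (\<integral>\<^sup>+x. h x \<partial>lborel)"
  proof -
    have "ennreal W * (\<integral>\<^sup>+u. \<integral>\<^sup>+x. r u x \<partial>lborel \<partial>lborel)
      = (\<integral>\<^sup>+u. \<integral>\<^sup>+x. ennreal W * r u x \<partial>lborel \<partial>lborel)"
      by (simp add: nn_integral_cmult)
    also have "\<dots> = (\<integral>\<^sup>+x. \<integral>\<^sup>+u. ennreal W * r u x \<partial>lborel \<partial>lborel)"
      by (intro lborel_pair.Fubini'[symmetric]) measurable
    also have "\<dots> \<le> (\<integral>\<^sup>+x. h x \<partial>lborel)"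
      unfolding r_def using W by (intro nn_integral_mono nn_integral_superlevel_le)
    finally show ?thesis .
  qed
  have scale: "ennreal (c / D) \<le> X" if "ennreal c < Y" "Y \<le> ennreal D * X" "D > 0" "c > 0" for c D X Y
  proof (cases X)
    case (real x)
    then have "ennreal c \<le> ennreal (D * x)" using that by (simp add: ennreal_mult)
    then have "c \<le> D * x" using that real by (simp add: ennreal_le_iff2)
    then show ?thesis using that real by (simp add: ennreal_leI field_simps)
  qed simp
  \<comment> \<open>Dividing by the heights makes the weighted arithmetic-geometric mean inequality
    applicable to the normalised integrals, for which the additive bound is available.\<close>
  have "a powr (1 - l) * b powr l = W * ((a / A) powr (1 - l) * (b / B) powr l)"
    using A B a b by (simp add: W_def powr_divide)
  also have "\<dots> \<le> W * ((1 - l) * (a / A) + l * (b / B))"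
    using W A B a b l by (intro mult_left_mono Youngs_inequality_0) auto
  finally have "ennreal (a powr (1 - l) * b powr l) \<le> ennreal (W * ((1 - l) * (a / A) + l * (b / B)))"
    by (rule ennreal_leI)
  also have "\<dots> = ennreal W * (ennreal (1 - l) * ennreal (a / A) + ennreal l * ennreal (b / B))"
    using W A B a b l by (simp add: ennreal_mult ennreal_plus del: times_divide_eq_right)
  also have "\<dots> \<le> ennreal W * (ennreal (1 - l) * (\<integral>\<^sup>+u. \<integral>\<^sup>+x. p u x \<partial>lborel \<partial>lborel)
      + ennreal l * (\<integral>\<^sup>+u. \<integral>\<^sup>+x. q u x \<partial>lborel \<partial>lborel))"
    using scale[OF a(2) f_le A(1) a(1)] scale[OF b(2) g_le B(1) b(1)]
    by (intro mult_left_mono add_mono) auto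
  also have "\<dots> = ennreal W * (\<integral>\<^sup>+u. ennreal (1 - l) * (\<integral>\<^sup>+x. p u x \<partial>lborel)
      + ennreal l * (\<integral>\<^sup>+x. q u x \<partial>lborel) \<partial>lborel)"
    by (subst nn_integral_add) (auto simp: nn_integral_cmult)
  also have "\<dots> \<le> ennreal W * (\<integral>\<^sup>+u. \<integral>\<^sup>+x. r u x \<partial>lborel \<partial>lborel)"
    by (intro mult_left_mono nn_integral_mono cut) auto
  also note h_ge
  finally show ?thesis .
qed

text \<open>Monotone convergence; the bound is stated for all large n so that two functions can be
  truncated at a common height.\<close>

lemma less_nn_integral_truncate:
  fixes f :: "'a \<Rightarrow> ennreal"
  assumes [measurable]: "f \<in> borel_measurable M" and c: "c < (\<integral>\<^sup>+x. f x \<partial>M)"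
  shows "\<exists>N::nat. \<forall>n\<ge>N. c < (\<integral>\<^sup>+x. min (f x) (of_nat n) \<partial>M)"
proof -
  have "(SUP N::nat. min y (of_nat N)) = y" for y :: ennreal
    using inf_SUP[of y "\<lambda>N::nat. of_nat N" UNIV] by (simp add: inf_min ennreal_SUP_of_nat_eq_top)
  then have "(\<integral>\<^sup>+x. f x \<partial>M) = (\<integral>\<^sup>+x. (SUP N::nat. min (f x) (of_nat N)) \<partial>M)" by simp
  also have "\<dots> = (SUP N::nat. \<integral>\<^sup>+x. min (f x) (of_nat N) \<partial>M)"
    by (intro nn_integral_monotone_convergence_SUP)
       (auto simp: incseq_def le_fun_def intro!: min.coboundedI2 of_nat_mono)
  finally obtain N :: nat where N: "c < (\<integral>\<^sup>+x. min (f x) (of_nat N) \<partial>M)"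
    using c by (auto simp: less_SUP_iff)
  have "c < (\<integral>\<^sup>+x. min (f x) (of_nat n) \<partial>M)" if "n \<ge> N" for n
    using N by (rule less_le_trans) (intro nn_integral_mono min.mono order_refl of_nat_mono that)
  then show ?thesis by blast
qed

lemma prekopa_leindler_real:
  fixes f g h :: "real \<Rightarrow> ennreal" and l a b :: real
  assumes l: "0 < l" "l < 1"
    and m[measurable]: "f \<in> borel_measurable borel" "g \<in> borel_measurable borel" "h \<in> borel_measurable borel"
    and fgh: "\<And>x y a b. 0 < a \<Longrightarrow> 0 < b \<Longrightarrow> ennreal a < f x \<Longrightarrow> ennreal b < g y \<Longrightarrow>
      ennreal (a powr (1 - l) * b powr l) \<le> h ((1 - l) * x + l * y)"
    and a: "0 < a" "ennreal a < (\<integral>\<^sup>+x. f x \<partial>lborel)"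
    and b: "0 < b" "ennreal b < (\<integral>\<^sup>+x. g x \<partial>lborel)"
  shows "ennreal (a powr (1 - l) * b powr l) \<le> (\<integral>\<^sup>+x. h x \<partial>lborel)"
proof -
  obtain N1 N2 :: nat where
    "\<forall>n\<ge>N1. ennreal a < (\<integral>\<^sup>+x. min (f x) (of_nat n) \<partial>lborel)"
    "\<forall>n\<ge>N2. ennreal b < (\<integral>\<^sup>+x. min (g x) (of_nat n) \<partial>lborel)"
    using less_nn_integral_truncate[of f lborel] less_nn_integral_truncate[of g lborel] a b m by fastforce
  then have N: "ennreal a < (\<integral>\<^sup>+x. min (f x) (of_nat (max N1 N2)) \<partial>lborel)"
    "ennreal b < (\<integral>\<^sup>+x. min (g x) (of_nat (max N1 N2)) \<partial>lborel)" by simp_all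
  \<comment> \<open>A level below the truncation of f or g is also below the function itself, so the
    hypothesis survives with the same h.\<close>
  show ?thesis
  proof (rule prekopa_leindler_real_bounded[OF l _ _ m(3) _ _ _ a(1) N(1) b(1) N(2)])
    show "min (f x) (of_nat (max N1 N2)) \<le> ennreal (max N1 N2)"
      "min (g x) (of_nat (max N1 N2)) \<le> ennreal (max N1 N2)" for x
      by (simp_all only: ennreal_of_nat_eq_real_of_nat min.cobounded2)
  qed (use fgh in auto)
qed

text \<open>
  The hypothesis is \<open>f(x)\<^sup>1\<^sup>-\<^sup>l g(y)\<^sup>l \<le> h((1-l)x + ly)\<close>, and the conclusion the same inequality between
  the integrals; real lower bounds \<open>a\<close>, \<open>b\<close> stand for the two factors because there is no power
  function on extended nonnegative reals.
\<close>

lemma prekopa_leindler: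
  fixes f g h :: "(nat \<Rightarrow> real) \<Rightarrow> ennreal" and l a b :: real
  assumes "finite I" and l: "0 < l" "l < 1"
    and "f \<in> borel_measurable (lebesgue_on_coords I)" "g \<in> borel_measurable (lebesgue_on_coords I)"
      "h \<in> borel_measurable (lebesgue_on_coords I)"
    and "\<And>x y a b. x \<in> space (lebesgue_on_coords I) \<Longrightarrow> y \<in> space (lebesgue_on_coords I) \<Longrightarrow>
      0 < a \<Longrightarrow> 0 < b \<Longrightarrow> ennreal a < f x \<Longrightarrow> ennreal b < g y \<Longrightarrow>
      ennreal (a powr (1 - l) * b powr l) \<le> h (\<lambda>i\<in>I. (1 - l) * x i + l * y i)"
    and "0 < a" "ennreal a < integral\<^sup>N (lebesgue_on_coords I) f"
    and "0 < b" "ennreal b < integral\<^sup>N (lebesgue_on_coords I) g"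
  shows "ennreal (a powr (1 - l) * b powr l) \<le> integral\<^sup>N (lebesgue_on_coords I) h"
  using assms(1,4-)
proof (induction I arbitrary: f g h a b rule: finite_induct)
  case empty
  \<comment> \<open>Over no coordinates the space is a single point and the integrals are
    evaluations there, so the pointwise hypothesis is already the claim.\<close>
  have "(\<lambda>_. undefined) \<in> space (lebesgue_on_coords {})" by (simp add: space_PiM)
  then have "ennreal (a powr (1 - l) * b powr l) \<le> h (\<lambda>i\<in>{}. (1 - l) * undefined + l * undefined)"
    using empty.prems(5-) by (intro empty.prems(4)) (auto simp: lebesgue_product.nn_integral_empty)
  then show ?case by (simp add: lebesgue_product.nn_integral_empty restrict_def)
next
  case (insert i I)
  let ?L = "lebesgue_on_coords I"
  note [measurable] = insert.prems(1-3)
  interpret L: sigma_finite_measure ?L by (rule lebesgue_product.sigma_finite) fact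
  have upd: "x(i := s) \<in> space (lebesgue_on_coords (insert i I))" if "x \<in> space ?L" for x :: "nat \<Rightarrow> real" and s
    using that by (auto simp: space_PiM PiE_iff extensional_def)
  have meas: "(\<lambda>s. \<integral>\<^sup>+x. F (x(i := s)) \<partial>?L) \<in> borel_measurable borel"
    "(\<lambda>x. F (x(i := s))) \<in> borel_measurable ?L"
    if [measurable]: "F \<in> borel_measurable (lebesgue_on_coords (insert i I))" for F :: "_ \<Rightarrow> ennreal" and s
    by measurable
  have split: "integral\<^sup>N (lebesgue_on_coords (insert i I)) F = (\<integral>\<^sup>+s. \<integral>\<^sup>+x. F (x(i := s)) \<partial>?L \<partial>lborel)"
    if "F \<in> borel_measurable (lebesgue_on_coords (insert i I))" for F :: "_ \<Rightarrow> ennreal"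
    using insert.hyps that by (intro lebesgue_product.product_nn_integral_insert_rev) auto
  show ?case
    \<comment> \<open>The one-dimensional inequality is applied to the integrals over slices as
      functions of the new coordinate. Its hypothesis is the conclusion of the induction hypothesis
      for two slices and the slice between them.\<close>
    unfolding split[OF insert.prems(3)]
  proof (rule prekopa_leindler_real[OF l meas(1)[OF insert.prems(1)] meas(1)[OF insert.prems(2)]
        meas(1)[OF insert.prems(3)] _ insert.prems(5) _ insert.prems(7)])
    show "ennreal a < (\<integral>\<^sup>+s. \<integral>\<^sup>+x. f (x(i := s)) \<partial>?L \<partial>lborel)"
      using insert.prems(6) by (simp only: split[OF insert.prems(1)])
    show "ennreal b < (\<integral>\<^sup>+s. \<integral>\<^sup>+x. g (x(i := s)) \<partial>?L \<partial>lborel)"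
      using insert.prems(8) by (simp only: split[OF insert.prems(2)])
    fix s t a b :: real
    assume ab: "0 < a" "0 < b" "ennreal a < (\<integral>\<^sup>+x. f (x(i := s)) \<partial>?L)"
      "ennreal b < (\<integral>\<^sup>+x. g (x(i := t)) \<partial>?L)"
    show "ennreal (a powr (1 - l) * b powr l) \<le> (\<integral>\<^sup>+x. h (x(i := (1 - l) * s + l * t)) \<partial>?L)"
    proof (rule insert.IH[OF meas(2)[OF insert.prems(1)] meas(2)[OF insert.prems(2)]
          meas(2)[OF insert.prems(3)] _ ab(1) ab(3) ab(2) ab(4)])
      fix x y :: "nat \<Rightarrow> real" and a b :: real
      assume xy: "x \<in> space ?L" "y \<in> space ?L" "0 < a" "0 < b" "ennreal a < f (x(i := s))" "ennreal b < g (y(i := t))"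
      have eq: "(\<lambda>j\<in>insert i I. (1 - l) * (x(i := s)) j + l * (y(i := t)) j)
        = (\<lambda>j\<in>I. (1 - l) * x j + l * y j)(i := (1 - l) * s + l * t)"
        using insert.hyps by (auto simp: fun_eq_iff)
      show "ennreal (a powr (1 - l) * b powr l)
          \<le> h ((\<lambda>j\<in>I. (1 - l) * x j + l * y j)(i := (1 - l) * s + l * t))"
        using insert.prems(4)[OF upd upd, OF xy] by (simp only: eq)
    qed
  qed
qed

section \<open>Log-concave functions in the plane\<close>

text \<open>Every x strictly between 0 and s has the form l s, with s - x = (1 - l) s. On that
  interval of length \<open>\<bar>s\<bar>\<close> the integrand of the self-convolution of
  \<open>\<phi>\<close> at s is at least \<open>\<phi> 0 * \<phi> s\<close>, and the total mass of
  the self-convolution is the square of the integral of \<open>\<phi>\<close>.\<close>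

lemma nn_integral_abs_mult_le:
  fixes \<phi> :: "real \<Rightarrow> ennreal"
  assumes [measurable]: "\<phi> \<in> borel_measurable borel"
    and lc: "\<And>s l. 0 < l \<Longrightarrow> l < 1 \<Longrightarrow> \<phi> 0 * \<phi> s \<le> \<phi> (l * s) * \<phi> ((1 - l) * s)"
  shows "\<phi> 0 * (\<integral>\<^sup>+s. ennreal \<bar>s\<bar> * \<phi> s \<partial>lborel) \<le> (\<integral>\<^sup>+x. \<phi> x \<partial>lborel)\<^sup>2"
proof -
  have "\<phi> 0 * (\<integral>\<^sup>+s. ennreal \<bar>s\<bar> * \<phi> s \<partial>lborel) = (\<integral>\<^sup>+s. \<phi> 0 * \<phi> s * ennreal \<bar>s\<bar> \<partial>lborel)"
    by (subst nn_integral_cmult[symmetric]) (auto simp: mult_ac)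
  also have "\<dots> \<le> (\<integral>\<^sup>+s. \<integral>\<^sup>+x. \<phi> x * \<phi> (s - x) \<partial>lborel \<partial>lborel)"
  proof (rule nn_integral_mono)
    fix s :: real
    have "\<phi> 0 * \<phi> s * ennreal \<bar>s\<bar> = (\<integral>\<^sup>+x. \<phi> 0 * \<phi> s * indicator {min 0 s<..<max 0 s} x \<partial>lborel)"
      by (simp add: nn_integral_cmult abs_real_def)
    also have "\<dots> \<le> (\<integral>\<^sup>+x. \<phi> x * \<phi> (s - x) \<partial>lborel)"
    proof (rule nn_integral_mono)
      fix x :: real
      show "\<phi> 0 * \<phi> s * indicator {min 0 s<..<max 0 s} x \<le> \<phi> x * \<phi> (s - x)"
      proof (cases "x \<in> {min 0 s<..<max 0 s}")
        case True
        then have "s \<noteq> 0" "0 < x / s" "x / s < 1"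
          by (auto simp: min_def max_def divide_simps split: if_splits)
        with lc[of "x / s" s] True show ?thesis by (simp add: left_diff_distrib)
      qed simp
    qed
    finally show "\<phi> 0 * \<phi> s * ennreal \<bar>s\<bar> \<le> (\<integral>\<^sup>+x. \<phi> x * \<phi> (s - x) \<partial>lborel)" .
  qed
  also have "\<dots> = (\<integral>\<^sup>+x. \<integral>\<^sup>+s. \<phi> x * \<phi> (s - x) \<partial>lborel \<partial>lborel)"
    by (intro lborel_pair.Fubini') measurable
  also have "\<dots> = (\<integral>\<^sup>+x. \<phi> x * (\<integral>\<^sup>+y. \<phi> y \<partial>lborel) \<partial>lborel)"
  proof (intro nn_integral_cong)
    fix x :: real
    show "(\<integral>\<^sup>+s. \<phi> x * \<phi> (s - x) \<partial>lborel) = \<phi> x * (\<integral>\<^sup>+y. \<phi> y \<partial>lborel)"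
      using nn_integral_real_affine[of \<phi> 1 "-x"] by (simp add: nn_integral_cmult)
  qed
  also have "\<dots> = (\<integral>\<^sup>+x. \<phi> x \<partial>lborel)\<^sup>2"
    by (simp add: nn_integral_multc power2_eq_square)
  finally show ?thesis .
qed

text \<open>Substitute y = t x for fixed x; the line x = 0, where this degenerates, is a null
  set.\<close>

lemma nn_integral_slope_coordinates:
  fixes G :: "real \<Rightarrow> real \<Rightarrow> ennreal"
  assumes [measurable]: "case_prod G \<in> borel_measurable (lborel \<Otimes>\<^sub>M lborel)"
  shows "(\<integral>\<^sup>+x. \<integral>\<^sup>+y. G x y \<partial>lborel \<partial>lborel)
    = (\<integral>\<^sup>+t. \<integral>\<^sup>+x. ennreal \<bar>x\<bar> * G x (t * x) \<partial>lborel \<partial>lborel)"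
proof -
  have "(\<integral>\<^sup>+x. \<integral>\<^sup>+y. G x y \<partial>lborel \<partial>lborel)
    = (\<integral>\<^sup>+x. \<integral>\<^sup>+t. ennreal \<bar>x\<bar> * G x (t * x) \<partial>lborel \<partial>lborel)"
  proof (rule nn_integral_cong_AE)
    have "(\<integral>\<^sup>+y. G x y \<partial>lborel) = (\<integral>\<^sup>+t. ennreal \<bar>x\<bar> * G x (t * x) \<partial>lborel)" if "x \<noteq> 0" for x
      using that nn_integral_real_affine[of "G x" x 0] by (simp add: nn_integral_cmult mult.commute)
    then show "AE x in lborel. (\<integral>\<^sup>+y. G x y \<partial>lborel) = (\<integral>\<^sup>+t. ennreal \<bar>x\<bar> * G x (t * x) \<partial>lborel)"
      using AE_lborel_singleton[of 0] by (auto elim: eventually_mono)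
  qed
  also have "\<dots> = (\<integral>\<^sup>+t. \<integral>\<^sup>+x. ennreal \<bar>x\<bar> * G x (t * x) \<partial>lborel \<partial>lborel)"
    by (intro lborel_pair.Fubini'[symmetric]) measurable
  finally show ?thesis .
qed

lemma nn_integral_inverse_1_plus_square:
  "(\<integral>\<^sup>+t. ennreal (inverse (1 + t\<^sup>2)) \<partial>lborel) = ennreal pi"
proof -
  have "integrable lborel (\<lambda>t::real. inverse (1 + t\<^sup>2))" "integral\<^sup>L lborel (\<lambda>t::real. inverse (1 + t\<^sup>2)) = pi"
    using integrable_inverse_1_plus_square LBINT_inverse_1_plus_square
    by (auto simp: set_integrable_def interval_lebesgue_integral_def set_lebesgue_integral_def)
  then show ?thesis by (subst nn_integral_eq_integral) auto
qed

text \<open>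
  If the claim failed for every \<open>t\<close>, slope coordinates would bound \<open>p\<close> by \<open>\<pi>/4\<close> times itself.
\<close>

lemma ex_slope_integral_large:
  fixes G :: "real \<Rightarrow> real \<Rightarrow> ennreal"
  assumes m[measurable]: "case_prod G \<in> borel_measurable (lborel \<Otimes>\<^sub>M lborel)"
    and lc: "\<And>t s l. 0 < l \<Longrightarrow> l < 1 \<Longrightarrow>
      G 0 0 * G s (t * s) \<le> G (l * s) (t * (l * s)) * G ((1 - l) * s) (t * ((1 - l) * s))"
    and P: "G 0 0 * (\<integral>\<^sup>+x. \<integral>\<^sup>+y. G x y \<partial>lborel \<partial>lborel) = ennreal p"
  shows "\<exists>t. ennreal p \<le> 4 * (ennreal (1 + t\<^sup>2) * (\<integral>\<^sup>+x. G x (t * x) \<partial>lborel)\<^sup>2)"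
proof (rule ccontr)
  assume "\<not> ?thesis"
  then have neg: "4 * (ennreal (1 + t\<^sup>2) * (\<integral>\<^sup>+x. G x (t * x) \<partial>lborel)\<^sup>2) < ennreal p" for t
    by (simp add: not_le)
  then have p: "p > 0" using le_less_trans[OF zero_le neg] by simp
  have bound: "(\<integral>\<^sup>+x. G x (t * x) \<partial>lborel)\<^sup>2 \<le> ennreal (p / 4) * ennreal (inverse (1 + t\<^sup>2))" for t
  proof (cases "(\<integral>\<^sup>+x. G x (t * x) \<partial>lborel)\<^sup>2")
    case (real r)
    have pos: "1 + t\<^sup>2 > 0" by (simp add: add_pos_nonneg)
    have "ennreal (4 * ((1 + t\<^sup>2) * r)) < ennreal p"
      using neg[of t] real pos by (simp add: ennreal_mult)
    then have "4 * ((1 + t\<^sup>2) * r) \<le> p" using real by (simp add: ennreal_less_iff)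
    then have "r \<le> p / 4 * inverse (1 + t\<^sup>2)" using pos by (simp add: field_simps)
    then show ?thesis using real p pos by (simp add: ennreal_leI flip: ennreal_mult)
  next
    case top
    then have "4 * (ennreal (1 + t\<^sup>2) * (\<integral>\<^sup>+x. G x (t * x) \<partial>lborel)\<^sup>2) = \<top>"
      by (simp add: ennreal_mult_top ennreal_eq_0_iff add_nonneg_pos not_le)
    then show ?thesis using neg[of t] by simp
  qed
  have "ennreal p = (\<integral>\<^sup>+t. G 0 0 * (\<integral>\<^sup>+x. ennreal \<bar>x\<bar> * G x (t * x) \<partial>lborel) \<partial>lborel)"
    unfolding P[symmetric] nn_integral_slope_coordinates[OF m] by (simp add: nn_integral_cmult)
  also have "\<dots> \<le> (\<integral>\<^sup>+t. (\<integral>\<^sup>+x. G x (t * x) \<partial>lborel)\<^sup>2 \<partial>lborel)"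
  proof (rule nn_integral_mono)
    fix t :: real
    show "G 0 0 * (\<integral>\<^sup>+x. ennreal \<bar>x\<bar> * G x (t * x) \<partial>lborel) \<le> (\<integral>\<^sup>+x. G x (t * x) \<partial>lborel)\<^sup>2"
      using nn_integral_abs_mult_le[of "\<lambda>x. G x (t * x)"] lc[of _ _ t] by simp
  qed
  also have "\<dots> \<le> (\<integral>\<^sup>+t. ennreal (p / 4) * ennreal (inverse (1 + t\<^sup>2)) \<partial>lborel)"
    by (intro nn_integral_mono bound)
  also have "\<dots> = ennreal (p / 4) * ennreal pi"
    by (simp add: nn_integral_cmult nn_integral_inverse_1_plus_square)
  also have "\<dots> = ennreal (p / 4 * pi)" using p by (subst ennreal_mult) auto
  finally have "p \<le> p / 4 * pi" using p by (subst (asm) ennreal_le_iff) auto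
  moreover have "p * pi < p * 4" using p pi_less_4 by (intro mult_strict_left_mono) auto
  ultimately show False by simp
qed

section \<open>Volumes as integrals\<close>

text \<open>Inverse of the restriction used in \<open>vol\<close>: it passes from functions that are
  undefined from index n on to those that vanish there.\<close>

definition zero_extension :: "nat \<Rightarrow> (nat \<Rightarrow> real) \<Rightarrow> nat \<Rightarrow> real"
  where "zero_extension n x = (\<lambda>i. if i < n then x i else 0)"

lemma borel_measurable_fun:
  fixes f :: "'a \<Rightarrow> nat \<Rightarrow> real"
  assumes "\<And>i. (\<lambda>x. f x i) \<in> borel_measurable M"
  shows "f \<in> borel_measurable M"
  by (rule measurable_coordinatewise_then_product) (rule assms)

lemma measurable_zero_extension:
  "zero_extension n \<in> borel_measurable (lebesgue_on_coords {..<n})"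
proof (rule borel_measurable_fun)
  fix i
  show "(\<lambda>x. zero_extension n x i) \<in> borel_measurable (lebesgue_on_coords {..<n})"
    by (cases "i < n") (simp_all add: zero_extension_def)
qed

lemma measurable_lincomb:
  "lincomb m u \<in> borel_measurable (lebesgue_on_coords {..<m})"
  unfolding lincomb_def by (intro borel_measurable_fun) measurable

lemma sets_borel_Rn: "Rn m \<in> sets borel"
proof -
  have "Rn m = (\<Inter>i\<in>{m..}. (\<lambda>x. x i) -` {0})" by (auto simp: topspace_Euclidean_space)
  also have "\<dots> \<in> sets borel"
  proof (rule sets.countable_INT'')
    fix i :: nat
    have "(\<lambda>x::nat \<Rightarrow> real. x i) \<in> borel_measurable borel" by measurable
    from measurable_sets_borel[OF this, of "{0}"]
    show "(\<lambda>x::nat \<Rightarrow> real. x i) -` {0} \<in> sets borel" by simp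
  qed auto
  finally show ?thesis .
qed

lemma zero_extension_in_Rn: "zero_extension n x \<in> Rn n"
  by (simp add: zero_extension_def topspace_Euclidean_space)

text \<open>\<open>measure\<close> returns 0 on sets of infinite measure, so the coordinate bound,
  which puts A inside a cube, is what makes the two sides agree. The completion in
  \<open>vol\<close> has no effect on a Borel set.\<close>

lemma vol_eq_nn_integral:
  assumes A: "A \<in> sets borel" "A \<subseteq> Rn n" and bd: "\<And>x i. x \<in> A \<Longrightarrow> i < n \<Longrightarrow> \<bar>x i\<bar> \<le> R"
  shows "ennreal (vol n A) = (\<integral>\<^sup>+x. indicator A (zero_extension n x) \<partial>lebesgue_on_coords {..<n})"
proof -
  let ?L = "lebesgue_on_coords {..<n}"
  define S where "S = zero_extension n -` A \<inter> space ?L"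
  have S: "S \<in> sets ?L" unfolding S_def by (rule measurable_sets[OF measurable_zero_extension A(1)])
  have "(\<lambda>x. restrict x {..<n}) ` A = S"
  proof
    show "(\<lambda>x. restrict x {..<n}) ` A \<subseteq> S"
    proof safe
      fix x assume x: "x \<in> A"
      then have "zero_extension n (restrict x {..<n}) = x"
        using A(2) by (force simp: zero_extension_def topspace_Euclidean_space fun_eq_iff)
      then show "restrict x {..<n} \<in> S" using x by (simp add: S_def space_PiM)
    qed
    show "S \<subseteq> (\<lambda>x. restrict x {..<n}) ` A"
    proof
      fix x assume x: "x \<in> S"
      have "x = restrict (zero_extension n x) {..<n}"
        using x by (auto simp: S_def zero_extension_def fun_eq_iff space_PiM PiE_iff extensional_def)
      then show "x \<in> (\<lambda>x. restrict x {..<n}) ` A" using x by (auto simp: S_def)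
    qed
  qed
  then have "vol n A = measure ?L S" using S by (simp add: vol_def measure_completion)
  moreover have "emeasure ?L S < \<top>"
  proof -
    have "S \<subseteq> Pi\<^sub>E {..<n} (\<lambda>_. {-R..R})"
    proof
      fix x assume x: "x \<in> S"
      have "x i \<in> {-R..R}" if "i < n" for i
        using bd[of "zero_extension n x" i] x that by (auto simp: S_def zero_extension_def)
      then show "x \<in> Pi\<^sub>E {..<n} (\<lambda>_. {-R..R})" using x by (auto simp: S_def space_PiM PiE_iff)
    qed
    then have "emeasure ?L S \<le> emeasure ?L (Pi\<^sub>E {..<n} (\<lambda>_. {-R..R}))"
      by (intro emeasure_mono sets_PiM_I_finite) auto
    also have "\<dots> = (\<Prod>i<n. emeasure lborel {-R..R})"
      by (intro lebesgue_product.emeasure_PiM) auto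
    also have "\<dots> < \<top>" by (auto simp: emeasure_lborel_Icc_eq power_less_top_ennreal)
    finally show ?thesis .
  qed
  ultimately have "ennreal (vol n A) = emeasure ?L S" by (simp add: emeasure_eq_ennreal_measure)
  also have "\<dots> = (\<integral>\<^sup>+x. indicator S x \<partial>?L)" using S by simp
  also have "\<dots> = (\<integral>\<^sup>+x. indicator A (zero_extension n x) \<partial>?L)"
    by (intro nn_integral_cong) (simp add: S_def indicator_def)
  finally show ?thesis .
qed

section \<open>Orthonormal bases and the independence of subspace volume from the basis\<close>

lemma dotp_commute: "dotp n x y = dotp n y x"
  by (simp add: dotp_def mult.commute)

lemma dotp_lincomb_left: "dotp n (lincomb m u t) y = (\<Sum>j<m. t j * dotp n (u j) y)"
proof -
  have "dotp n (lincomb m u t) y = (\<Sum>i<n. \<Sum>j<m. t j * (u j i * y i))"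
    by (simp add: dotp_def lincomb_def sum_distrib_right mult.assoc)
  also have "\<dots> = (\<Sum>j<m. \<Sum>i<n. t j * (u j i * y i))" by (rule sum.swap)
  finally show ?thesis by (simp add: dotp_def sum_distrib_left)
qed

lemma dotp_orthonormal_basis:
  assumes "orthonormal_basis n m u V" "j < m"
  shows "dotp n (lincomb m u t) (u j) = t j"
proof -
  have "dotp n (lincomb m u t) (u j) = (\<Sum>k<m. if k = j then t k else 0)"
    unfolding dotp_lincomb_left using assms
    by (intro sum.cong) (auto simp: orthonormal_basis_def)
  then show ?thesis using assms(2) by simp
qed

lemma orthonormal_basis_in_subspace:
  assumes "orthonormal_basis n m u V" "j < m"
  shows "u j \<in> V"
proof -
  have "u j = lincomb m u (\<lambda>k. if k = j then 1 else 0)"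
    using assms(2) by (simp add: lincomb_def if_distrib[where f="\<lambda>x. x * _"] cong: if_cong)
  then show ?thesis using assms(1) by (auto simp: orthonormal_basis_def)
qed

lemma orthonormal_basis_expansion:
  assumes b: "orthonormal_basis n m u V" and v: "v \<in> V"
  shows "v = lincomb m u (\<lambda>k. dotp n v (u k))"
proof -
  obtain t where t: "v = lincomb m u t" using b v by (auto simp: orthonormal_basis_def)
  have "lincomb m u t = lincomb m u (\<lambda>k. dotp n v (u k))"
    unfolding lincomb_def t[unfolded lincomb_def]
    using dotp_orthonormal_basis[OF b, of _ t] by (auto simp: lincomb_def)
  then show ?thesis using t by simp
qed

text \<open>The transition matrix of inner products between the two bases is orthogonal: expanding w
  in u gives orthonormal rows, expanding u in w gives orthonormal columns.\<close>

lemma nn_integral_orthonormal_basis_cong: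
  assumes u: "orthonormal_basis n m u V" and w: "orthonormal_basis n m w V"
    and A[measurable]: "A \<in> sets borel"
  shows "(\<integral>\<^sup>+x. indicator A (lincomb m u x) \<partial>lebesgue_on_coords {..<m})
    = (\<integral>\<^sup>+x. (indicator A (lincomb m w x) :: ennreal) \<partial>lebesgue_on_coords {..<m})"
proof -
  let ?L = "lebesgue_on_coords {..<m}"
  define T where "T k j = dotp n (w k) (u j)" for k j
  have uT: "u j = lincomb m w (\<lambda>k. T k j)" if "j < m" for j
    using orthonormal_basis_expansion[OF w orthonormal_basis_in_subspace[OF u that]]
    by (simp add: T_def dotp_commute)
  have wT: "w k = lincomb m u (\<lambda>j. T k j)" if "k < m" for k
    using orthonormal_basis_expansion[OF u orthonormal_basis_in_subspace[OF w that]]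
    by (simp add: T_def)
  have "(\<Sum>k<m. T i k * T j k) = dotp n (w i) (w j)" if "i < m" "j < m" for i j
  proof -
    have "dotp n (w i) (w j) = dotp n (lincomb m u (T i)) (w j)" using wT[OF that(1)] by simp
    moreover have "dotp n (u k) (w j) = T j k" for k by (simp add: T_def dotp_commute)
    ultimately show ?thesis by (simp only: dotp_lincomb_left)
  qed
  then have o1: "(\<Sum>k<m. T i k * T j k) = (if i = j then 1 else 0)" if "i < m" "j < m" for i j
    using w that by (simp add: orthonormal_basis_def)
  have "(\<Sum>k<m. T k i * T k j) = dotp n (u i) (u j)" if "i < m" "j < m" for i j
  proof -
    have "dotp n (u i) (u j) = dotp n (lincomb m w (\<lambda>k. T k i)) (u j)" using uT[OF that(1)] by simp
    then show ?thesis by (simp only: dotp_lincomb_left T_def)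
  qed
  then have o2: "(\<Sum>k<m. T k i * T k j) = (if i = j then 1 else 0)" if "i < m" "j < m" for i j
    using u that by (simp add: orthonormal_basis_def)
  have change: "lincomb m u x = lincomb m w (\<lambda>i\<in>{..<m}. \<Sum>j<m. T i j * x j)" for x
  proof
    fix i
    have "lincomb m u x i = (\<Sum>j<m. x j * u j i)" by (simp add: lincomb_def)
    also have "\<dots> = (\<Sum>j<m. \<Sum>k<m. (T k j * x j) * w k i)"
    proof (rule sum.cong[OF refl])
      fix j assume "j \<in> {..<m}"
      then have "u j i = (\<Sum>k<m. T k j * w k i)" using uT[of j] by (simp add: lincomb_def)
      then show "x j * u j i = (\<Sum>k<m. (T k j * x j) * w k i)" by (simp add: sum_distrib_left mult_ac)
    qed
    also have "\<dots> = (\<Sum>k<m. \<Sum>j<m. (T k j * x j) * w k i)" by (rule sum.swap)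
    also have "\<dots> = lincomb m w (\<lambda>i\<in>{..<m}. \<Sum>j<m. T i j * x j) i"
      by (simp add: lincomb_def sum_distrib_right)
    finally show "lincomb m u x i = \<dots>" .
  qed
  have meas: "(\<lambda>x. indicator A (lincomb m w x) :: ennreal) \<in> borel_measurable ?L"
    by (rule measurable_compose[OF measurable_lincomb]) auto
  show ?thesis
    unfolding change by (rule nn_integral_lebesgue_on_coords_orthogonal[OF o1 o2 meas])
qed

text \<open>Replaces the basis selected by \<open>SOME\<close> with any convenient basis w.\<close>

lemma subspace_vol_eq_nn_integral:
  assumes w: "orthonormal_basis n m w V" and A: "A \<in> sets borel"
    and bd: "\<And>x i. x \<in> A \<Longrightarrow> i < n \<Longrightarrow> \<bar>x i\<bar> \<le> R"
  shows "ennreal (subspace_vol n m V A) = (\<integral>\<^sup>+x. indicator A (lincomb m w x) \<partial>lebesgue_on_coords {..<m})"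
proof -
  define u where "u = (SOME u. orthonormal_basis n m u V)"
  have u: "orthonormal_basis n m u V" unfolding u_def by (rule someI[of "\<lambda>u. orthonormal_basis n m u V", OF w])
  define B where "B = {t \<in> Rn m. lincomb m u t \<in> A}"
  have ext: "lincomb m u (zero_extension m x) = lincomb m u x" for x
    by (simp add: lincomb_def zero_extension_def)
  have "lincomb m u \<in> borel_measurable borel"
    unfolding lincomb_def by (intro borel_measurable_fun) measurable
  then have "lincomb m u -` A \<in> sets borel" using measurable_sets_borel A by blast
  moreover note sets_borel_Rn[of m]
  moreover have "B = Rn m \<inter> lincomb m u -` A" by (auto simp: B_def)
  ultimately have "B \<in> sets borel" by auto
  \<comment> \<open>Coordinates in the basis are inner products with its vectors, so a bound on the
    ambient coordinates bounds them too; summing over j makes the bound uniform.\<close>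
  moreover have "\<bar>t j\<bar> \<le> (\<Sum>j<m. \<Sum>i<n. \<bar>R\<bar> * \<bar>u j i\<bar>)" if "t \<in> B" "j < m" for t j
  proof -
    have "\<bar>t j\<bar> = \<bar>\<Sum>i<n. lincomb m u t i * u j i\<bar>"
      using dotp_orthonormal_basis[OF u that(2), of t] by (simp add: dotp_def)
    also have "\<dots> \<le> (\<Sum>i<n. \<bar>lincomb m u t i * u j i\<bar>)" by (rule sum_abs)
    also have "\<dots> \<le> (\<Sum>i<n. \<bar>R\<bar> * \<bar>u j i\<bar>)"
    proof (rule sum_mono)
      fix i assume "i \<in> {..<n}"
      then have "\<bar>lincomb m u t i\<bar> \<le> \<bar>R\<bar>" using bd[of "lincomb m u t" i] that by (simp add: B_def)
      then show "\<bar>lincomb m u t i * u j i\<bar> \<le> \<bar>R\<bar> * \<bar>u j i\<bar>"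
        by (simp add: abs_mult mult_right_mono)
    qed
    also have "\<dots> \<le> (\<Sum>j<m. \<Sum>i<n. \<bar>R\<bar> * \<bar>u j i\<bar>)"
      using that by (intro member_le_sum sum_nonneg) auto
    finally show ?thesis .
  qed
  ultimately have "ennreal (vol m B) = (\<integral>\<^sup>+x. indicator B (zero_extension m x) \<partial>lebesgue_on_coords {..<m})"
    by (intro vol_eq_nn_integral) (auto simp: B_def)
  also have "\<dots> = (\<integral>\<^sup>+x. indicator A (lincomb m u x) \<partial>lebesgue_on_coords {..<m})"
    by (intro nn_integral_cong) (simp add: B_def indicator_def zero_extension_in_Rn ext)
  also have "\<dots> = (\<integral>\<^sup>+x. indicator A (lincomb m w x) \<partial>lebesgue_on_coords {..<m})"
    by (rule nn_integral_orthonormal_basis_cong[OF u w A])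
  finally show ?thesis by (simp add: subspace_vol_def B_def u_def Let_def)
qed

section \<open>Sections by translates of a coordinate subspace\<close>

text \<open>The point (x, a, b) of the space of dimension m + 2. Entries of x from index m on are
  ignored, so x may come from the product space, where they are undefined.\<close>

definition append2 :: "nat \<Rightarrow> (nat \<Rightarrow> real) \<Rightarrow> real \<Rightarrow> real \<Rightarrow> nat \<Rightarrow> real"
  where "append2 m x a b = (\<lambda>i. if i < m then x i else if i = m then a else if i = Suc m then b else 0)"

text \<open>The function G of the overview, as an extended nonnegative integral so that Fubini and
  Prekopa-Leindler apply without finiteness conditions.\<close>

definition section_vol :: "nat \<Rightarrow> (nat \<Rightarrow> real) set \<Rightarrow> real \<Rightarrow> real \<Rightarrow> ennreal"
  where "section_vol m K a b = (\<integral>\<^sup>+x. indicator K (append2 m x a b) \<partial>lebesgue_on_coords {..<m})"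

lemma measurable_append2:
  assumes "f \<in> measurable M (lebesgue_on_coords {..<m})" "g \<in> borel_measurable M" "h \<in> borel_measurable M"
  shows "(\<lambda>w. append2 m (f w) (g w) (h w)) \<in> borel_measurable M"
proof (rule borel_measurable_fun)
  fix i
  have "(\<lambda>w. f w i) \<in> borel_measurable M" if "i < m"
    using measurable_compose[OF assms(1) measurable_component_singleton[of i]] that by simp
  then show "(\<lambda>w. append2 m (f w) (g w) (h w) i) \<in> borel_measurable M"
    using assms by (cases "i < m") (simp_all add: append2_def)
qed

lemma measurable_section_vol:
  assumes K: "K \<in> sets borel"
  shows "case_prod (section_vol m K) \<in> borel_measurable (lborel \<Otimes>\<^sub>M lborel)"
proof -
  let ?L = "lebesgue_on_coords {..<m}"
  interpret L: sigma_finite_measure ?L by (rule lebesgue_product.sigma_finite) simp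
  have "(\<lambda>w. append2 m (snd w) (fst (fst w)) (snd (fst w))) \<in> borel_measurable ((lborel \<Otimes>\<^sub>M lborel) \<Otimes>\<^sub>M ?L)"
    by (rule measurable_append2) measurable
  from measurable_compose[OF this borel_measurable_indicator[OF K]]
  have "(\<lambda>(p, x). indicator K (append2 m x (fst p) (snd p)) :: ennreal)
      \<in> borel_measurable ((lborel \<Otimes>\<^sub>M lborel) \<Otimes>\<^sub>M ?L)"
    by (simp add: split_beta')
  from L.borel_measurable_nn_integral[OF this] show ?thesis
    by (simp add: section_vol_def split_beta')
qed

lemma section_vol_log_concave:
  assumes K: "K \<in> sets borel" and l: "0 < l" "l < 1"
    and cv: "\<And>x y. x \<in> K \<Longrightarrow> y \<in> K \<Longrightarrow> (\<lambda>i. (1 - l) * x i + l * y i) \<in> K"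
    and a: "0 < a" "ennreal a < section_vol m K p q"
    and b: "0 < b" "ennreal b < section_vol m K r s"
  shows "ennreal (a powr (1 - l) * b powr l) \<le> section_vol m K ((1 - l) * p + l * r) ((1 - l) * q + l * s)"
proof -
  have meas: "(\<lambda>x. indicator K (append2 m x a b) :: ennreal) \<in> borel_measurable (lebesgue_on_coords {..<m})" for a b
    by (rule measurable_compose[OF measurable_append2 borel_measurable_indicator[OF K]]) auto
  show ?thesis
    unfolding section_vol_def
  proof (rule prekopa_leindler[OF _ l meas meas meas _ a(1) a(2)[unfolded section_vol_def]
        b(1) b(2)[unfolded section_vol_def]])
    fix x y :: "nat \<Rightarrow> real" and a b :: real
    assume ab: "0 < a" "0 < b" "ennreal a < indicator K (append2 m x p q)" "ennreal b < indicator K (append2 m y r s)"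
    \<comment> \<open>A positive number strictly below an indicator forces the indicator to be 1 and
      the number to be less than 1. The hypothesis of Prekopa-Leindler thus reduces to convexity of
      K.\<close>
    have "append2 m x p q \<in> K \<and> a < 1" "append2 m y r s \<in> K \<and> b < 1"
      using ab by (auto simp: indicator_def of_bool_def ennreal_less_one_iff split: if_splits)
    moreover have "(\<lambda>i. (1 - l) * append2 m x p q i + l * append2 m y r s i)
      = append2 m (\<lambda>i\<in>{..<m}. (1 - l) * x i + l * y i) ((1 - l) * p + l * r) ((1 - l) * q + l * s)"
      by (auto simp: append2_def fun_eq_iff)
    ultimately have "append2 m (\<lambda>i\<in>{..<m}. (1 - l) * x i + l * y i) ((1 - l) * p + l * r) ((1 - l) * q + l * s) \<in> K"
      "a < 1" "b < 1" using cv[of "append2 m x p q" "append2 m y r s"] by auto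
    moreover have "a powr (1 - l) * b powr l \<le> 1"
      using ab l \<open>a < 1\<close> \<open>b < 1\<close> by (intro mult_le_one powr_le1) auto
    ultimately show "ennreal (a powr (1 - l) * b powr l) \<le> indicator K
      (append2 m (\<lambda>i\<in>{..<m}. (1 - l) * x i + l * y i) ((1 - l) * p + l * r) ((1 - l) * q + l * s))"
      by simp
  qed simp
qed

text \<open>Returns from real lower bounds to a product of extended values: each value is the
  supremum of the positive reals strictly below it, with the empty supremum 0 in the case of
  0.\<close>

lemma ennreal_mult_le_via_real:
  fixes X Y Z :: ennreal
  assumes "\<And>a b. 0 < a \<Longrightarrow> 0 < b \<Longrightarrow> ennreal a < X \<Longrightarrow> ennreal b < Y \<Longrightarrow> ennreal (a * b) \<le> Z"
  shows "X * Y \<le> Z"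
proof -
  have approx: "W = (SUP a\<in>{a. 0 < a \<and> ennreal a < W}. ennreal a)" for W :: ennreal
  proof (rule antisym)
    show "W \<le> (SUP a\<in>{a. 0 < a \<and> ennreal a < W}. ennreal a)"
    proof (rule dense_le)
      fix y assume y: "y < W"
      show "y \<le> (SUP a\<in>{a. 0 < a \<and> ennreal a < W}. ennreal a)"
      proof (cases "y = 0")
        case False
        obtain c where c: "y = ennreal c" "c \<ge> 0" using y by (cases y) auto
        then show ?thesis using y False by (auto intro!: SUP_upper simp: less_le)
      qed simp
    qed
  qed (auto intro: SUP_least)
  have row: "X * ennreal b \<le> Z" if b: "0 < b" "ennreal b < Y" for b
  proof -
    have "X * ennreal b = (SUP a\<in>{a. 0 < a \<and> ennreal a < X}. ennreal a) * ennreal b"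
      using approx[of X] by (rule arg_cong)
    also have "\<dots> = (SUP a\<in>{a. 0 < a \<and> ennreal a < X}. ennreal a * ennreal b)"
      by (rule SUP_mult_right_ennreal)
    also have "\<dots> \<le> Z" using assms b by (intro SUP_least) (simp add: ennreal_mult)
    finally show ?thesis .
  qed
  have "X * Y = X * (SUP b\<in>{b. 0 < b \<and> ennreal b < Y}. ennreal b)"
    using approx[of Y] by (rule arg_cong)
  also have "\<dots> = (SUP b\<in>{b. 0 < b \<and> ennreal b < Y}. X * ennreal b)"
    by (rule SUP_mult_left_ennreal)
  also have "\<dots> \<le> Z" by (intro SUP_least row) auto
  finally show ?thesis .
qed

text \<open>Log-concavity between the origin and the point is used twice, with weights l and 1 - l.
  In the product of the two bounds both exponents add up to 1.\<close>

lemma section_vol_ray: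
  assumes K: "K \<in> sets borel" and l: "0 < l" "l < 1"
    and cv: "\<And>x y l. x \<in> K \<Longrightarrow> y \<in> K \<Longrightarrow> 0 < l \<Longrightarrow> l < 1 \<Longrightarrow> (\<lambda>i. (1 - l) * x i + l * y i) \<in> K"
  shows "section_vol m K 0 0 * section_vol m K s (t * s)
    \<le> section_vol m K (l * s) (t * (l * s)) * section_vol m K ((1 - l) * s) (t * ((1 - l) * s))"
proof (rule ennreal_mult_le_via_real)
  fix a b :: real
  assume ab: "0 < a" "0 < b" "ennreal a < section_vol m K 0 0" "ennreal b < section_vol m K s (t * s)"
  have "ennreal (a powr (1 - l) * b powr l) \<le> section_vol m K ((1 - l) * 0 + l * s) ((1 - l) * 0 + l * (t * s))"
    using l cv by (intro section_vol_log_concave[OF K _ _ _ ab(1,3,2,4)]) auto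
  moreover have "ennreal (a powr (1 - (1 - l)) * b powr (1 - l))
      \<le> section_vol m K ((1 - (1 - l)) * 0 + (1 - l) * s) ((1 - (1 - l)) * 0 + (1 - l) * (t * s))"
    using l cv[of _ _ "1 - l"] by (intro section_vol_log_concave[OF K _ _ _ ab(1,3,2,4)]) auto
  ultimately have "ennreal (a powr (1 - l) * b powr l) * ennreal (a powr l * b powr (1 - l))
    \<le> section_vol m K (l * s) (t * (l * s)) * section_vol m K ((1 - l) * s) (t * ((1 - l) * s))"
    by (intro mult_mono) (auto simp: mult.left_commute)
  moreover have "(a powr (1 - l) * b powr l) * (a powr l * b powr (1 - l)) = a * b"
  proof -
    have "a powr (1 - l) * a powr l = a" "b powr l * b powr (1 - l) = b"
      using ab by (simp_all flip: powr_add)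
    then show ?thesis by (simp add: mult_ac) (metis mult.assoc mult.commute)
  qed
  ultimately show "ennreal (a * b)
    \<le> section_vol m K (l * s) (t * (l * s)) * section_vol m K ((1 - l) * s) (t * ((1 - l) * s))"
    by (simp flip: ennreal_mult)
qed

lemma vol_eq_nn_integral_section_vol:
  assumes K: "K \<in> sets borel" "K \<subseteq> Rn (Suc (Suc m))"
    and bd: "\<And>x i. x \<in> K \<Longrightarrow> i < Suc (Suc m) \<Longrightarrow> \<bar>x i\<bar> \<le> R"
  shows "ennreal (vol (Suc (Suc m)) K) = (\<integral>\<^sup>+a. \<integral>\<^sup>+b. section_vol m K a b \<partial>lborel \<partial>lborel)"
proof -
  let ?f = "\<lambda>x. indicator K (zero_extension (Suc (Suc m)) x) :: ennreal"
  have f: "?f \<in> borel_measurable (lebesgue_on_coords {..<Suc (Suc m)})"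
    by (rule measurable_compose[OF measurable_zero_extension borel_measurable_indicator[OF K(1)]])
  have eq: "?f (x(m := a, Suc m := b)) = indicator K (append2 m x a b)" for x a b
    by (intro arg_cong[where f="indicator K"]) (auto simp: zero_extension_def append2_def fun_eq_iff)
  have "ennreal (vol (Suc (Suc m)) K) = integral\<^sup>N (lebesgue_on_coords {..<Suc (Suc m)}) ?f"
    using K bd by (intro vol_eq_nn_integral[where R=R]) auto
  also have "\<dots> = (\<integral>\<^sup>+b. \<integral>\<^sup>+x. ?f (x(Suc m := b)) \<partial>lebesgue_on_coords {..<Suc m} \<partial>lborel)"
    using f unfolding lessThan_Suc[of "Suc m"]
    by (intro lebesgue_product.product_nn_integral_insert_rev) auto
  also have "\<dots> = (\<integral>\<^sup>+b. \<integral>\<^sup>+a. \<integral>\<^sup>+x. ?f (x(m := a, Suc m := b)) \<partial>lebesgue_on_coords {..<m} \<partial>lborel \<partial>lborel)"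
  proof (rule nn_integral_cong)
    fix b :: real
    have "(\<lambda>x. x(Suc m := b)) \<in> measurable (lebesgue_on_coords {..<Suc m}) (lebesgue_on_coords {..<Suc (Suc m)})"
      unfolding lessThan_Suc[of "Suc m"] by measurable
    from measurable_compose[OF this f]
    show "(\<integral>\<^sup>+x. ?f (x(Suc m := b)) \<partial>lebesgue_on_coords {..<Suc m})
      = (\<integral>\<^sup>+a. \<integral>\<^sup>+x. ?f (x(m := a, Suc m := b)) \<partial>lebesgue_on_coords {..<m} \<partial>lborel)"
      unfolding lessThan_Suc[of m]
      by (intro lebesgue_product.product_nn_integral_insert_rev) auto
  qed
  also have "\<dots> = (\<integral>\<^sup>+b. \<integral>\<^sup>+a. section_vol m K a b \<partial>lborel \<partial>lborel)"
    by (simp only: eq section_vol_def)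
  also have "\<dots> = (\<integral>\<^sup>+a. \<integral>\<^sup>+b. section_vol m K a b \<partial>lborel \<partial>lborel)"
    by (intro lborel_pair.Fubini' measurable_section_vol K)
  finally show ?thesis .
qed

section \<open>Hyperplanes containing the coordinate subspace\<close>

lemma sets_borel_perp_singleton: "perp n {v} \<in> sets borel"
proof -
  have "(\<lambda>x. dotp n x v) \<in> borel_measurable borel"
    unfolding dotp_def by measurable
  from measurable_sets_borel[OF this, of "{0}"]
  have "(\<lambda>x. dotp n x v) -` {0} \<in> sets borel" by simp
  moreover have "perp n {v} = Rn n \<inter> (\<lambda>x. dotp n x v) -` {0}" by (auto simp: perp_def)
  ultimately show ?thesis using sets_borel_Rn by auto
qed

lemma convex_body_compact:
  assumes "convex_body n K"
  shows "compact K" "K \<subseteq> Rn n"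
  using assms
  by (auto simp: convex_body_def Euclidean_space_def compactin_subtopology topspace_Euclidean_space
      euclidean_product_topology compactin_euclidean_iff)

lemma compact_coordinates_bounded:
  fixes K :: "(nat \<Rightarrow> real) set"
  assumes "compact K"
  shows "\<exists>R. \<forall>x\<in>K. \<forall>i<n. \<bar>x i\<bar> \<le> R"
proof -
  have "\<exists>r. \<forall>x\<in>K. \<bar>x i\<bar> \<le> r" for i
  proof -
    have "compact ((\<lambda>x. x i) ` K)"
      by (intro compact_continuous_image assms continuous_on_subset[OF continuous_on_product_coordinates]) auto
    then have "bounded ((\<lambda>x. x i) ` K)" by (rule compact_imp_bounded)
    then show ?thesis by (auto simp: bounded_iff)
  qed
  then obtain r where r: "\<And>i x. x \<in> K \<Longrightarrow> \<bar>x i\<bar> \<le> r i" by metis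
  have "\<bar>x i\<bar> \<le> (\<Sum>i<n. \<bar>r i\<bar>)" if "x \<in> K" "i < n" for x i
  proof -
    have "\<bar>x i\<bar> \<le> \<bar>r i\<bar>" using r[OF that(1), of i] by simp
    also have "\<dots> \<le> (\<Sum>i<n. \<bar>r i\<bar>)" using that by (intro member_le_sum) auto
    finally show ?thesis .
  qed
  then show ?thesis by blast
qed

lemma append2_in_Rn: "append2 m x a b \<in> Rn (Suc (Suc m))"
  by (auto simp: append2_def topspace_Euclidean_space)

lemma dotp_append2_append2:
  "dotp (Suc (Suc m)) (append2 m x a b) (append2 m y c d) = dotp m x y + a * c + b * d"
  by (simp add: dotp_def append2_def)

lemma append2_eqI:
  assumes "z \<in> Rn (Suc (Suc m))" "a = z m" "b = z (Suc m)"
  shows "append2 m z a b = z"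
  using assms by (auto simp: append2_def topspace_Euclidean_space fun_eq_iff not_less_less_Suc_eq)

lemma dotp_zero_right[simp]: "dotp n x (\<lambda>_. 0) = 0"
  by (simp add: dotp_def)

lemma dotp_append2_right:
  assumes "z \<in> Rn (Suc (Suc m))"
  shows "dotp (Suc (Suc m)) z (append2 m (\<lambda>_. 0) c d) = z m * c + z (Suc m) * d"
  by (subst append2_eqI[OF assms refl refl, symmetric]) (simp add: dotp_append2_append2)

section \<open>Adapted orthonormal frames and the two sections\<close>

text \<open>The standard basis of the first m coordinates followed by the direction (c, s) in the
  last two. Its first m vectors span the codimension-two subspace and its first m + 1 the
  hyperplane, so one frame serves both.\<close>

definition plane_frame :: "nat \<Rightarrow> real \<Rightarrow> real \<Rightarrow> nat \<Rightarrow> nat \<Rightarrow> real"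
  where "plane_frame m c s j =
    (if j < m then (\<lambda>i. if i = j then 1 else 0) else append2 m (\<lambda>_. 0) c s)"

lemma lincomb_plane_frame:
  "lincomb m (plane_frame m c s) x = append2 m x 0 0"
  "lincomb (Suc m) (plane_frame m c s) x = append2 m x (c * x m) (s * x m)"
proof -
  have *: "(\<Sum>j<m. x j * plane_frame m c s j i) = (if i < m then x i else 0)" for i
  proof -
    have "(\<Sum>j<m. x j * plane_frame m c s j i) = (\<Sum>j<m. if j = i then x j else 0)"
      by (intro sum.cong) (auto simp: plane_frame_def)
    then show ?thesis by simp
  qed
  then show "lincomb m (plane_frame m c s) x = append2 m x 0 0"
    by (auto simp: lincomb_def append2_def)
  from * show "lincomb (Suc m) (plane_frame m c s) x = append2 m x (c * x m) (s * x m)"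
    by (auto simp: lincomb_def append2_def plane_frame_def[of m c s m])
qed

lemma plane_frame_orthonormal:
  assumes cs: "c\<^sup>2 + s\<^sup>2 = 1" and ij: "i < Suc m" "j < Suc m"
  shows "dotp (Suc (Suc m)) (plane_frame m c s i) (plane_frame m c s j) = (if i = j then 1 else 0)"
proof -
  have e: "plane_frame m c s k = append2 m (\<lambda>i. if i = k then 1 else 0) 0 0" if "k < m" for k
    using that by (auto simp: plane_frame_def append2_def)
  have p: "plane_frame m c s m = append2 m (\<lambda>_. 0) c s" by (simp add: plane_frame_def)
  have d: "dotp m (\<lambda>i. if i = k then 1 else 0) y = y k" if "k < m" for k y
  proof -
    have "dotp m (\<lambda>i. if i = k then 1 else 0) y = (\<Sum>i<m. if i = k then y i else 0)"
      unfolding dotp_def by (intro sum.cong) auto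
    then show ?thesis using that by simp
  qed
  show ?thesis
    using ij cs
    by (cases "i < m"; cases "j < m")
       (auto simp: e p d dotp_append2_append2 less_Suc_eq power2_eq_square dotp_commute[of _ "\<lambda>_. 0"])
qed

lemma orthonormal_basis_hyperplane:
  assumes cs: "c\<^sup>2 + s\<^sup>2 = 1"
  shows "orthonormal_basis (Suc (Suc m)) (Suc m) (plane_frame m c s)
    (perp (Suc (Suc m)) {append2 m (\<lambda>_. 0) (- s) c})"
proof -
  have "z \<in> range (lincomb (Suc m) (plane_frame m c s))"
    if "z \<in> perp (Suc (Suc m)) {append2 m (\<lambda>_. 0) (- s) c}" for z
  proof -
    have z: "z \<in> Rn (Suc (Suc m))" "c * z (Suc m) = s * z m"
      using that dotp_append2_right[of z m] by (auto simp: perp_def mult.commute)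
    \<comment> \<open>The component of z along (c, s). Orthogonality to (-s, c) makes (c r, s r) the
      last two coordinates of z; position m then stores r as the last frame coordinate.\<close>
    define r where "r = c * z m + s * z (Suc m)"
    have "c * r = (c\<^sup>2 + s\<^sup>2) * z m" "s * r = (c\<^sup>2 + s\<^sup>2) * z (Suc m)"
      using z(2) unfolding r_def by algebra+
    then have "append2 m z (c * r) (s * r) = z" using z cs by (intro append2_eqI) auto
    moreover have "append2 m (z(m := r)) (c * r) (s * r) = append2 m z (c * r) (s * r)"
      by (auto simp: append2_def)
    ultimately have "lincomb (Suc m) (plane_frame m c s) (z(m := r)) = z"
      by (simp add: lincomb_plane_frame del: fun_upd_apply add: fun_upd_same)
    then show ?thesis by (metis rangeI)
  qed
  moreover have "lincomb (Suc m) (plane_frame m c s) x \<in> perp (Suc (Suc m)) {append2 m (\<lambda>_. 0) (- s) c}" for x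
    by (simp add: perp_def lincomb_plane_frame append2_in_Rn dotp_append2_append2)
  ultimately show ?thesis
    using plane_frame_orthonormal[OF cs] by (auto simp: orthonormal_basis_def)
qed

lemma orthonormal_basis_codim2:
  assumes cs: "c\<^sup>2 + s\<^sup>2 = 1"
  shows "orthonormal_basis (Suc (Suc m)) m (plane_frame m c s)
    (perp (Suc (Suc m)) {append2 m (\<lambda>_. 0) (- s) c, append2 m (\<lambda>_. 0) c s})"
proof -
  have "z \<in> range (lincomb m (plane_frame m c s))"
    if "z \<in> perp (Suc (Suc m)) {append2 m (\<lambda>_. 0) (- s) c, append2 m (\<lambda>_. 0) c s}" for z
  proof -
    have z: "z \<in> Rn (Suc (Suc m))" "c * z (Suc m) = s * z m" "c * z m + s * z (Suc m) = 0"
      using that dotp_append2_right[of z m] by (auto simp: perp_def mult.commute)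
    have "(c\<^sup>2 + s\<^sup>2) * z m = 0" "(c\<^sup>2 + s\<^sup>2) * z (Suc m) = 0"
      using z(2,3) by algebra+
    then have "append2 m z 0 0 = z" using z(1) cs by (intro append2_eqI) auto
    then have "lincomb m (plane_frame m c s) z = z" by (simp add: lincomb_plane_frame)
    then show ?thesis by (metis rangeI)
  qed
  moreover have "lincomb m (plane_frame m c s) x
      \<in> perp (Suc (Suc m)) {append2 m (\<lambda>_. 0) (- s) c, append2 m (\<lambda>_. 0) c s}" for x
    by (simp add: perp_def lincomb_plane_frame append2_in_Rn dotp_append2_append2)
  ultimately show ?thesis
    using plane_frame_orthonormal[OF cs] by (auto simp: orthonormal_basis_def)
qed

lemma append2_in_nsphere:
  assumes "c\<^sup>2 + s\<^sup>2 = 1"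
  shows "append2 m (\<lambda>_. 0) c s \<in> topspace (nsphere (Suc m))"
proof -
  have "(\<Sum>i\<le>Suc m. (append2 m (\<lambda>_. 0) c s i)\<^sup>2) = 1"
    using assms by (simp add: append2_def lessThan_Suc_atMost[symmetric])
  then show ?thesis
    using append2_in_Rn[of m "\<lambda>_. 0" c s] by (simp add: nsphere_def)
qed

text \<open>The right-hand side is free of c and s, which expresses that all rotated pairs of
  normals cut out the same codimension-two section.\<close>

lemma subspace_vol_codim2_section:
  assumes cs: "c\<^sup>2 + s\<^sup>2 = 1" and K: "K \<in> sets borel"
    and bd: "\<And>x i. x \<in> K \<Longrightarrow> i < Suc (Suc m) \<Longrightarrow> \<bar>x i\<bar> \<le> R"
  defines "H \<equiv> perp (Suc (Suc m)) {append2 m (\<lambda>_. 0) (- s) c, append2 m (\<lambda>_. 0) c s}"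
  shows "ennreal (subspace_vol (Suc (Suc m)) m H (K \<inter> H)) = section_vol m K 0 0"
proof -
  note basis = orthonormal_basis_codim2[OF cs, of m, folded H_def]
  have "H = perp (Suc (Suc m)) {append2 m (\<lambda>_. 0) (- s) c} \<inter> perp (Suc (Suc m)) {append2 m (\<lambda>_. 0) c s}"
    by (auto simp: H_def perp_def)
  then have "K \<inter> H \<in> sets borel" using K sets_borel_perp_singleton by auto
  then have "ennreal (subspace_vol (Suc (Suc m)) m H (K \<inter> H))
    = (\<integral>\<^sup>+x. indicator (K \<inter> H) (lincomb m (plane_frame m c s) x) \<partial>lebesgue_on_coords {..<m})"
    using bd by (intro subspace_vol_eq_nn_integral[OF basis, where R=R]) auto
  moreover have "lincomb m (plane_frame m c s) x \<in> H" for x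
    using basis by (auto simp: orthonormal_basis_def)
  ultimately show ?thesis
    by (simp add: section_vol_def indicator_inter_arith lincomb_plane_frame(1))
qed

text \<open>Fubini in the last frame coordinate; since (c, s) is a unit vector, r is arc length and
  no factor appears.\<close>

lemma subspace_vol_hyperplane_section:
  assumes cs: "c\<^sup>2 + s\<^sup>2 = 1" and K: "K \<in> sets borel"
    and bd: "\<And>x i. x \<in> K \<Longrightarrow> i < Suc (Suc m) \<Longrightarrow> \<bar>x i\<bar> \<le> R"
  defines "H \<equiv> perp (Suc (Suc m)) {append2 m (\<lambda>_. 0) (- s) c}"
  shows "ennreal (subspace_vol (Suc (Suc m)) (Suc m) H (K \<inter> H))
    = (\<integral>\<^sup>+r. section_vol m K (c * r) (s * r) \<partial>lborel)"
proof -
  let ?f = "\<lambda>x. indicator K (append2 m x (c * x m) (s * x m)) :: ennreal"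
  note basis = orthonormal_basis_hyperplane[OF cs, of m, folded H_def]
  have "K \<inter> H \<in> sets borel" using K sets_borel_perp_singleton by (auto simp: H_def)
  then have "ennreal (subspace_vol (Suc (Suc m)) (Suc m) H (K \<inter> H))
    = (\<integral>\<^sup>+x. indicator (K \<inter> H) (lincomb (Suc m) (plane_frame m c s) x) \<partial>lebesgue_on_coords {..<Suc m})"
    using bd by (intro subspace_vol_eq_nn_integral[OF basis, where R=R]) auto
  also have "\<dots> = integral\<^sup>N (lebesgue_on_coords {..<Suc m}) ?f"
  proof -
    have "lincomb (Suc m) (plane_frame m c s) x \<in> H" for x
      using basis by (auto simp: orthonormal_basis_def)
    then show ?thesis by (simp add: indicator_inter_arith lincomb_plane_frame(2))
  qed
  also have "\<dots> = (\<integral>\<^sup>+r. \<integral>\<^sup>+x. ?f (x(m := r)) \<partial>lebesgue_on_coords {..<m} \<partial>lborel)"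
  proof -
    have "?f \<in> borel_measurable (lebesgue_on_coords {..<Suc m})"
      using measurable_compose[OF measurable_lincomb[of "Suc m" "plane_frame m c s"] borel_measurable_indicator[OF K]]
      by (simp add: lincomb_plane_frame)
    then show ?thesis unfolding lessThan_Suc
      by (intro lebesgue_product.product_nn_integral_insert_rev) auto
  qed
  also have "\<dots> = (\<integral>\<^sup>+r. section_vol m K (c * r) (s * r) \<partial>lborel)"
  proof -
    have "append2 m (x(m := r)) a b = append2 m x a b" for x a b r
      by (auto simp: append2_def)
    then show ?thesis by (simp add: section_vol_def del: fun_upd_apply add: fun_upd_same)
  qed
  finally show ?thesis .
qed

section \<open>Choice of the slope and return to real volumes\<close>

theorem corollary6:
  shows "\<exists>c::real. c > 0 \<and>
    (\<forall>n::nat. n \<ge> 2 \<longrightarrow>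
      (\<forall>K :: (nat \<Rightarrow> real) set. convex_body n K \<and> origin_symmetric K \<longrightarrow>
        (\<exists>\<xi>\<in>topspace (nsphere (n - 1)). \<exists>\<nu>\<in>topspace (nsphere (n - 1)).
          \<xi> \<noteq> \<nu> \<and> \<xi> \<noteq> (\<lambda>i. - \<nu> i) \<and>
          subspace_vol n (n - 1) (perp n {\<xi>}) (K \<inter> perp n {\<xi>})
            \<ge> c * sqrt (subspace_vol n (n - 2) (perp n {\<xi>, \<nu>}) (K \<inter> perp n {\<xi>, \<nu>}) * vol n K))))"
proof (intro exI[of _ "1/2"] conjI allI impI)
  fix n :: nat and K :: "(nat \<Rightarrow> real) set"
  assume "2 \<le> n" and body: "convex_body n K \<and> origin_symmetric K"
  \<comment> \<open>The value m = 0 is included: the product over no coordinates is one point of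
    mass 1.\<close>
  then obtain m where n: "n = Suc (Suc m)" by (metis Suc_le_D numeral_2_eq_2 Suc_le_mono)
  note cb = convex_body_compact[OF conjunct1[OF body]]
  have K: "K \<in> sets borel" using cb(1) by (simp add: borel_closed compact_imp_closed)
  obtain R where R: "\<And>x i. x \<in> K \<Longrightarrow> i < n \<Longrightarrow> \<bar>x i\<bar> \<le> R"
    using compact_coordinates_bounded[OF cb(1), of n] by blast
  have cv: "(\<lambda>i. (1 - l) * x i + l * y i) \<in> K" if "x \<in> K" "y \<in> K" "0 < l" "l < 1" for x y l
    using body that by (auto simp: convex_body_def)
  define v where "v = vol n K"
  have v: "ennreal v = (\<integral>\<^sup>+a. \<integral>\<^sup>+b. section_vol m K a b \<partial>lborel \<partial>lborel)" "v \<ge> 0"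
    using vol_eq_nn_integral_section_vol[OF K _ , of m R] cb(2) R by (auto simp: v_def n vol_def)
  \<comment> \<open>The central section is computed with the pair at c = 1, s = 0, before the slope
    is known; \<open>h'\<close> later transfers it to the chosen pair.\<close>
  define h where "h = subspace_vol n m (perp n {append2 m (\<lambda>_. 0) (- 0) 1, append2 m (\<lambda>_. 0) 1 0})
    (K \<inter> perp n {append2 m (\<lambda>_. 0) (- 0) 1, append2 m (\<lambda>_. 0) 1 0})"
  have nonneg: "subspace_vol n k V A \<ge> 0" for k V A
    by (simp add: subspace_vol_def Let_def vol_def)
  have h: "section_vol m K 0 0 = ennreal h" "h \<ge> 0"
    using subspace_vol_codim2_section[of 1 0 K m R] K R nonneg by (auto simp: h_def n)
  obtain t where t: "ennreal (h * v) \<le> 4 * (ennreal (1 + t\<^sup>2) * (\<integral>\<^sup>+x. section_vol m K x (t * x) \<partial>lborel)\<^sup>2)"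
  proof -
    have "section_vol m K 0 0 * (\<integral>\<^sup>+a. \<integral>\<^sup>+b. section_vol m K a b \<partial>lborel \<partial>lborel) = ennreal (h * v)"
      using h v by (simp add: ennreal_mult)
    from ex_slope_integral_large[OF measurable_section_vol[OF K] section_vol_ray[OF K _ _ cv] this]
    show ?thesis using that by blast
  qed
  \<comment> \<open>Cosine and sine of the angle of the line of slope t, so that
    \<open>\<nu>\<close> points along the line and \<open>\<xi>\<close> is the normal of the
    hyperplane.\<close>
  define c where "c = 1 / sqrt (1 + t\<^sup>2)"
  define s where "s = t * c"
  have q: "1 + t\<^sup>2 > 0" by (simp add: add_pos_nonneg)
  have c: "c > 0" "c\<^sup>2 = 1 / (1 + t\<^sup>2)" using q by (auto simp: c_def power_divide)
  have "c\<^sup>2 + s\<^sup>2 = (1 + t\<^sup>2) * c\<^sup>2" by (simp add: s_def power_mult_distrib algebra_simps)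
  then have cs: "c\<^sup>2 + s\<^sup>2 = 1" using c(2) q by simp
  then have cs': "(- s)\<^sup>2 + c\<^sup>2 = 1" by simp
  define \<xi> where "\<xi> = append2 m (\<lambda>_. 0) (- s) c"
  define \<nu> where "\<nu> = append2 m (\<lambda>_. 0) c s"
  define I where "I = subspace_vol n (Suc m) (perp n {\<xi>}) (K \<inter> perp n {\<xi>})"
  have "ennreal I = (\<integral>\<^sup>+r. section_vol m K (c * r) (s * r) \<partial>lborel)"
    using subspace_vol_hyperplane_section[OF cs K, of m R] R by (simp add: I_def \<xi>_def n)
  \<comment> \<open>Substituting x = c r passes to arc length. The square of the factor c cancels
    \<open>1 + t\<^sup>2\<close>.\<close>
  moreover have "(\<integral>\<^sup>+x. section_vol m K x (t * x) \<partial>lborel)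
    = ennreal c * (\<integral>\<^sup>+r. section_vol m K (c * r) (s * r) \<partial>lborel)"
  proof -
    note [measurable] = measurable_section_vol[OF K, of m]
    show ?thesis
      using nn_integral_real_affine[of "\<lambda>x. section_vol m K x (t * x)" c 0] c(1)
      by (simp add: s_def mult.assoc)
  qed
  ultimately have "ennreal (h * v) \<le> 4 * (ennreal (1 + t\<^sup>2) * (ennreal c * ennreal I)\<^sup>2)"
    using t by simp
  also have "\<dots> = ennreal (4 * ((1 + t\<^sup>2) * (c * I)\<^sup>2))"
  proof -
    have "I \<ge> 0" using nonneg by (simp add: I_def)
    then have "(ennreal c * ennreal I)\<^sup>2 = ennreal ((c * I)\<^sup>2)"
      using c(1) by (simp add: ennreal_power flip: ennreal_mult)
    then show ?thesis using q by (simp add: ennreal_mult)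
  qed
  also have "(1 + t\<^sup>2) * (c * I)\<^sup>2 = I\<^sup>2" using q c(2) by (simp add: power_mult_distrib)
  finally have "h * v \<le> 4 * I\<^sup>2" by (simp add: ennreal_le_iff)
  then have "sqrt (h * v) \<le> sqrt ((2 * I)\<^sup>2)" by (intro real_sqrt_le_mono) (simp add: power_mult_distrib)
  also have "\<dots> = 2 * I" using nonneg[of "Suc m"] by (intro real_sqrt_unique) (auto simp: I_def)
  finally have main: "1 / 2 * sqrt (h * v) \<le> I" by simp
  have h': "subspace_vol n m (perp n {\<xi>, \<nu>}) (K \<inter> perp n {\<xi>, \<nu>}) = h"
  proof -
    have "ennreal (subspace_vol n m (perp n {\<xi>, \<nu>}) (K \<inter> perp n {\<xi>, \<nu>})) = ennreal h"
      using subspace_vol_codim2_section[OF cs K, of m R] R h(1) by (simp add: \<xi>_def \<nu>_def n)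
    then show ?thesis using h(2) nonneg by (simp add: ennreal_inj)
  qed
  have "\<xi> m = - s" "\<xi> (Suc m) = c" "\<nu> m = c" "\<nu> (Suc m) = s"
    by (simp_all add: \<xi>_def \<nu>_def append2_def)
  \<comment> \<open>Either coincidence of the vectors up to sign would force c = 0.\<close>
  moreover have "\<not> (- s = c \<and> c = s)" "\<not> (- s = - c \<and> c = - s)" using c(1) by auto
  ultimately have ne: "\<xi> \<noteq> \<nu>" "\<xi> \<noteq> (\<lambda>i. - \<nu> i)" by metis+
  show "\<exists>\<xi>\<in>topspace (nsphere (n - 1)). \<exists>\<nu>\<in>topspace (nsphere (n - 1)).
          \<xi> \<noteq> \<nu> \<and> \<xi> \<noteq> (\<lambda>i. - \<nu> i) \<and>
          subspace_vol n (n - 1) (perp n {\<xi>}) (K \<inter> perp n {\<xi>})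
            \<ge> 1 / 2 * sqrt (subspace_vol n (n - 2) (perp n {\<xi>, \<nu>}) (K \<inter> perp n {\<xi>, \<nu>}) * vol n K)"
  proof (rule bexI[of _ \<xi>], rule bexI[of _ \<nu>], intro conjI)
    show "\<xi> \<in> topspace (nsphere (n - 1))" "\<nu> \<in> topspace (nsphere (n - 1))"
      using append2_in_nsphere[OF cs'] append2_in_nsphere[OF cs] by (simp_all add: \<xi>_def \<nu>_def n)
    have "n - 1 = Suc m" "n - 2 = m" by (simp_all add: n)
    then show "1 / 2 * sqrt (subspace_vol n (n - 2) (perp n {\<xi>, \<nu>}) (K \<inter> perp n {\<xi>, \<nu>}) * vol n K)
        \<le> subspace_vol n (n - 1) (perp n {\<xi>}) (K \<inter> perp n {\<xi>})"
      using main by (simp only: h' I_def v_def)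
  qed (use ne in auto)
qed simp

end
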